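(* For all integers $n\geq 0$, \[ d_{n}=\frac{7}{8}\,A_{n}\,\zeta (3)-3\,B_{n}, \] where $d_n=\dfrac{16^{n}}{n!^{2}}\displaystyle\int_{0}^{\infty }x^{2n+1}K_{0}(x)^{4}\,dx$, $A_{n}=\displaystyle\sum_{k=0}^{n}\binom{n}{k}^{2}\binom{2k}{k}\binom{2n-2k}{n-k}$, and $(B_n)_{n\geq 0}$ is the sequence with $B_{0}=0$, $B_{1}=1$ satisfying, for all $n\geq 0$, \[ (n+2)^{3}B_{n+2}-2(2n+3)(5n^{2}+15n+12)B_{n+1}+64(n+1)^{3}B_{n}=0 . \]
   Context: $K_{0}(x)=\int_{0}^{\infty }e^{-x\cosh t}\,dt$ for $x>0$ is the modified Bessel function of the second kind of order $0$, and $\zeta$ is the Riemann zeta function. (The sequence $A_n$ satisfies the same three-term recurrence as $B_n$, with $A_0=1$, $A_1=4$.) *)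

theory Defs
  imports "HOL-Analysis.Analysis"
begin

text \<open>Modified Bessel function of the second kind of order 0, for x > 0:
  K0 x = integral over t in [0, infinity) of exp(-x cosh t) dt (Lebesgue integral).\<close>
definition K0 :: "real \<Rightarrow> real" where
  "K0 x = (LINT t:{0..}|lborel. exp (- x * cosh t))"

definition zeta3 :: real where
  "zeta3 = (\<Sum>k. 1 / (real (Suc k)) ^ 3)"

definition d_seq :: "nat \<Rightarrow> real" where
  "d_seq n = 16 ^ n / (fact n) ^ 2 * (LINT x:{0<..}|lborel. x ^ (2*n+1) * (K0 x) ^ 4)"

definition A_seq :: "nat \<Rightarrow> real" where
  "A_seq n = (\<Sum>k=0..n. real ((n choose k)^2 * ((2*k) choose k) * ((2*n-2*k) choose (n-k))))"

end

(*
  Integration by parts relates the moments of K0^(4-j) (x K1)^j for varying j, and eliminating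
  j = 1, ..., 4 gives the three-term recurrence for d_n. The power series I0^4, whose coefficients
  are A_n / n!^2, satisfies the same differential relations, hence A_n the same recurrence. So only
  n = 0 and n = 1 remain. The relations also give int x^3 K0^4 = c/4 - 3/16 for c = int x K0^4,
  with the constant coming from the boundary value of (x K1)^4 at 0.

  To evaluate c, write cosh a + cosh b = 2 cosh s cosh t for a = s + t and b = s - t, which turns
  K0(x)^2 into an integral of K0(2 x cosh s). With
  int x K0(a x) K0(b x) dx = ln(a/b) / (a^2 - b^2) this gives a double integral of
  ln(cosh s / cosh t) / (cosh(s)^2 - cosh(t)^2). In the variables u = s + t and v = s - t the
  integrand is 2 artanh(tanh(u/2) tanh(v/2)) / (sinh u sinh v), and expanding artanh separates the
  variables and leaves the sum of 1 / (2k+1)^3, which is 7/8 zeta(3).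
*)
theory Submission
  imports Defs "HOL-Real_Asymp.Real_Asymp"
begin

section \<open>The integral of x K0(x)^4\<close>

lemma nn_integral_FTC_UNIV:
  fixes f F :: "real \<Rightarrow> real"
  assumes [measurable]: "f \<in> borel_measurable borel"
    and deriv: "\<And>x. (F has_real_derivative f x) (at x)"
    and nonneg: "\<And>x. 0 \<le> f x"
    and top: "(F \<longlongrightarrow> T) at_top" and bot: "(F \<longlongrightarrow> S) at_bot"
  shows "(\<integral>\<^sup>+x. ennreal (f x) \<partial>lborel) = ennreal (T - S)"
proof -
  have mono: "F x \<le> F y" if "x \<le> y" for x y
    using that deriv nonneg by (meson DERIV_nonneg_imp_nondecreasing)
  \<comment> \<open>Monotonicity puts \<open>F 0\<close> between the two limits, so both half-line
    integrals are nonnegative and \<open>ennreal\<close> adds them without truncation.\<close>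
  have T: "F 0 \<le> T"
    by (rule tendsto_lowerbound[OF top]) (auto intro!: eventually_at_top_linorderI[of 0] mono)
  have S: "S \<le> F 0"
    by (rule tendsto_upperbound[OF bot]) (auto intro: mono eventually_mono[OF eventually_le_at_bot[of 0]])
  have "(\<integral>\<^sup>+x. ennreal (f x) \<partial>lborel) =
      (\<integral>\<^sup>+x. ennreal (f x) * indicator {0..} x + ennreal (f x) * indicator {..<0} x \<partial>lborel)"
    by (rule nn_integral_cong) (auto simp: indicator_def)
  also have "\<dots> = (\<integral>\<^sup>+x. ennreal (f x) * indicator {0..} x \<partial>lborel) +
      (\<integral>\<^sup>+x. ennreal (f x) * indicator {..<0} x \<partial>lborel)"
    by (rule nn_integral_add) auto
  also have "(\<integral>\<^sup>+x. ennreal (f x) * indicator {0..} x \<partial>lborel) = ennreal (T - F 0)"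
    by (rule nn_integral_FTC_atLeast) (use assms in auto)
  also have "(\<integral>\<^sup>+x. ennreal (f x) * indicator {..<0} x \<partial>lborel) =
      (\<integral>\<^sup>+x. ennreal (f (0 + -1 * x)) * indicator {..<0} (0 + -1 * x) \<partial>lborel)"
    by (subst nn_integral_real_affine[where c = "-1" and t = 0]) auto
  also have "\<dots> = (\<integral>\<^sup>+x. ennreal (f (- x)) * indicator {0..} x \<partial>lborel)"
    by (rule nn_integral_cong_AE, use AE_lborel_singleton[of "0::real"] in eventually_elim)
       (auto simp: indicator_def)
  also have "\<dots> = ennreal (- S - (- F (- 0)))"
  proof (rule nn_integral_FTC_atLeast)
    show "((\<lambda>x. - F (- x)) has_real_derivative f (- x)) (at x)" for x
      by (auto intro!: derivative_eq_intros DERIV_chain2[OF deriv])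
    show "((\<lambda>x. - F (- x)) \<longlongrightarrow> - S) at_top"
      by (intro tendsto_minus) (use bot in \<open>simp add: filterlim_at_bot_mirror\<close>)
  qed (use nonneg in auto)
  finally show ?thesis
    using T S by (simp flip: ennreal_plus)
qed

text \<open>The factor 2 is the Jacobian of \<open>a = s + t\<close>, \<open>b = s - t\<close>. Two
  one-dimensional affine substitutions with an exchange of integrals in between replace a planar
  change of variables.\<close>

lemma nn_integral_rotate:
  fixes f :: "real \<Rightarrow> real \<Rightarrow> ennreal"
  assumes [measurable]: "(\<lambda>(a, b). f a b) \<in> borel_measurable (borel \<Otimes>\<^sub>M borel)"
  shows "(\<integral>\<^sup>+a. \<integral>\<^sup>+b. f a b \<partial>lborel \<partial>lborel) =
    2 * (\<integral>\<^sup>+s. \<integral>\<^sup>+t. f (s + t) (s - t) \<partial>lborel \<partial>lborel)"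
proof -
  have "(\<integral>\<^sup>+t. f (s + t) (s - t) \<partial>lborel) = (\<integral>\<^sup>+a. f a (- a + 2 * s) \<partial>lborel)" for s
    by (subst nn_integral_real_affine[where c = 1 and t = "- s"]) (auto simp: algebra_simps)
  then have "(\<integral>\<^sup>+s. \<integral>\<^sup>+t. f (s + t) (s - t) \<partial>lborel \<partial>lborel) =
      (\<integral>\<^sup>+a. \<integral>\<^sup>+s. f a (- a + 2 * s) \<partial>lborel \<partial>lborel)"
    by (simp only:) (rule lborel_pair.Fubini', simp)
  moreover have "(\<integral>\<^sup>+b. f a b \<partial>lborel) = 2 * (\<integral>\<^sup>+s. f a (- a + 2 * s) \<partial>lborel)" for a
    by (subst nn_integral_real_affine[where c = 2 and t = "- a"]) auto
  ultimately show ?thesis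
    by (simp add: nn_integral_cmult)
qed

text \<open>\<open>ennreal x\<close> vanishes for negative \<open>x\<close>, so this is an integral
  over the half-line in disguise.\<close>

lemma nn_integral_moment_exp:
  fixes c :: real
  assumes "c > 0"
  shows "(\<integral>\<^sup>+x. ennreal x * ennreal (exp (- c * x)) \<partial>lborel) = ennreal (1 / c\<^sup>2)"
proof -
  have "(\<integral>\<^sup>+x. ennreal x * ennreal (exp (- c * x)) \<partial>lborel) =
      (\<integral>\<^sup>+x. ennreal (x * exp (- c * x)) * indicator {0..} x \<partial>lborel)"
    by (rule nn_integral_cong) (auto simp: indicator_def ennreal_neg ennreal_mult)
  also have "\<dots> = ennreal (0 - (- (0 / c + 1 / c\<^sup>2) * exp (- c * 0)))"
  proof (rule nn_integral_FTC_atLeast)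
    show "((\<lambda>x. - (x / c + 1 / c\<^sup>2) * exp (- c * x)) has_real_derivative x * exp (- c * x)) (at x)" for x
      using assms by (auto intro!: derivative_eq_intros simp: field_simps power2_eq_square)
    show "((\<lambda>x. - (x / c + 1 / c\<^sup>2) * exp (- c * x)) \<longlongrightarrow> 0) at_top"
      using assms by real_asymp
  qed auto
  finally show ?thesis by simp
qed

text \<open>For \<open>x > 0\<close> this is \<open>2 K\<^sub>0(x)\<close>.\<close>
definition k0 :: "real \<Rightarrow> ennreal" where
  "k0 x = (\<integral>\<^sup>+t. ennreal (exp (- x * cosh t)) \<partial>lborel)"

section \<open>Products of \<open>k0\<close> and their exact integrals\<close>

lemma cosh_measurable [measurable]: "(cosh :: real \<Rightarrow> real) \<in> borel_measurable borel"
  by (intro borel_measurable_continuous_onI continuous_intros)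

lemma tanh_measurable [measurable]: "(tanh :: real \<Rightarrow> real) \<in> borel_measurable borel"
  unfolding tanh_def sinh_def by measurable

lemma k0_measurable [measurable]: "k0 \<in> borel_measurable borel"
  unfolding k0_def by measurable

lemma k0_mult:
  "k0 x * k0 y = (\<integral>\<^sup>+a. \<integral>\<^sup>+b. ennreal (exp (- x * cosh a - y * cosh b)) \<partial>lborel \<partial>lborel)"
proof -
  have "k0 x * k0 y = (\<integral>\<^sup>+a. ennreal (exp (- x * cosh a)) * k0 y \<partial>lborel)"
    by (subst nn_integral_multc) (auto simp: k0_def)
  also have "\<dots> = (\<integral>\<^sup>+a. \<integral>\<^sup>+b. ennreal (exp (- x * cosh a - y * cosh b)) \<partial>lborel \<partial>lborel)"
    unfolding k0_def
    by (rule nn_integral_cong, subst nn_integral_cmult[symmetric])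
       (auto simp flip: ennreal_mult exp_add)
  finally show ?thesis .
qed

text \<open>After the rotation, the exponent contains cosh(s+t) + cosh(s-t) = 2 cosh s cosh t, and
  the integral over \<open>t\<close> is again a value of \<open>k0\<close>.\<close>

lemma k0_square: "k0 x * k0 x = 2 * (\<integral>\<^sup>+s. k0 (2 * x * cosh s) \<partial>lborel)"
proof -
  have "- x * cosh (s + t) - x * cosh (s - t) = - (2 * x * cosh s) * cosh t" for s t
    by (simp add: cosh_add cosh_diff algebra_simps)
  then show ?thesis
    unfolding k0_mult by (subst nn_integral_rotate) (simp_all add: k0_def)
qed

text \<open>Up to a constant factor the integrand is the derivative of 1 / (A w + B) in the variable
  w = exp(2p).\<close>

lemma nn_integral_inverse_exp_square:
  fixes A B :: real
  assumes "A > 0" "B > 0"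
  shows "(\<integral>\<^sup>+p. ennreal (4 / (A * exp p + B * exp (- p))\<^sup>2) \<partial>lborel) = ennreal (2 / (A * B))"
proof -
  have "(\<integral>\<^sup>+p. ennreal (4 / (A * exp p + B * exp (- p))\<^sup>2) \<partial>lborel) = ennreal (0 - (- 2 / (A * B)))"
  proof (rule nn_integral_FTC_UNIV)
    show "((\<lambda>p. - 2 / (A * (A * exp (2 * p) + B))) has_real_derivative
        4 / (A * exp p + B * exp (- p))\<^sup>2) (at p)" for p
    proof -
      have pos: "A * exp (2 * p) + B > 0" using assms by (simp add: add_pos_pos)
      have e: "A * exp p + B * exp (- p) = (A * exp (2 * p) + B) / exp p"
        by (simp add: field_simps exp_minus flip: exp_add)
      have "((\<lambda>p. - 2 / (A * (A * exp (2 * p) + B))) has_real_derivative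
        2 * (A * (A * (2 * exp (2 * p)))) / (A * (A * exp (2 * p) + B))\<^sup>2) (at p)"
        using pos assms by (auto intro!: derivative_eq_intros simp: power2_eq_square)
      also have "2 * (A * (A * (2 * exp (2 * p)))) / (A * (A * exp (2 * p) + B))\<^sup>2 =
        4 * (exp p)\<^sup>2 / (A * exp (2 * p) + B)\<^sup>2"
      proof -
        have "exp p * exp p = exp (2 * p)" by (simp flip: exp_add)
        then show ?thesis
          using pos assms by (simp add: power2_eq_square)
      qed
      also have "\<dots> = 4 / (A * exp p + B * exp (- p))\<^sup>2"
        unfolding e using pos by (simp add: field_simps)
      finally show ?thesis .
    qed
    show "((\<lambda>p. - 2 / (A * (A * exp (2 * p) + B))) \<longlongrightarrow> 0) at_top"
      using assms by real_asymp
    show "((\<lambda>p. - 2 / (A * (A * exp (2 * p) + B))) \<longlongrightarrow> - 2 / (A * B)) at_bot"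
      using assms by (real_asymp simp: field_simps)
  qed auto
  then show ?thesis by simp
qed

text \<open>Partial fractions in exp(r) give a logarithmic antiderivative. Its argument runs from
  \<open>b / a\<close> to \<open>a / b\<close>, so the two ends contribute equally.\<close>

lemma nn_integral_inverse_exp_product:
  fixes a b :: real
  assumes "a > 0" "b > 0" "a \<noteq> b"
  shows "(\<integral>\<^sup>+r. ennreal (2 / ((a + b * exp r) * (a + b * exp (- r)))) \<partial>lborel) =
    ennreal (4 * ln (a / b) / (a\<^sup>2 - b\<^sup>2))"
proof -
  define D where "D = a\<^sup>2 - b\<^sup>2"
  have D: "D \<noteq> 0"
    using assms by (simp add: D_def power2_eq_iff)
  have "(\<integral>\<^sup>+r. ennreal (2 / ((a + b * exp r) * (a + b * exp (- r)))) \<partial>lborel) =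
    ennreal (2 / D * ln (a / b) - 2 / D * ln (b / a))"
  proof (rule nn_integral_FTC_UNIV)
    show "((\<lambda>r. 2 / D * ln ((b + a * exp r) / (a + b * exp r))) has_real_derivative
        2 / ((a + b * exp r) * (a + b * exp (- r)))) (at r)" for r
    proof -
      have pos: "b + a * exp r > 0" "a + b * exp r > 0"
        using assms by (simp_all add: add_pos_pos)
      have e: "a + b * exp (- r) = (b + a * exp r) / exp r"
        by (simp add: field_simps exp_minus)
      have "((\<lambda>r. ln (b + a * exp r) - ln (a + b * exp r)) has_real_derivative
        a * exp r / (b + a * exp r) - b * exp r / (a + b * exp r)) (at r)"
        using pos by (auto intro!: derivative_eq_intros simp: mult.commute)
      then have "((\<lambda>r. 2 / D * (ln (b + a * exp r) - ln (a + b * exp r))) has_real_derivative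
        2 / D * (a * exp r / (b + a * exp r) - b * exp r / (a + b * exp r))) (at r)"
        by (rule DERIV_cmult)
      also have "a * exp r / (b + a * exp r) - b * exp r / (a + b * exp r) =
          D * exp r / ((b + a * exp r) * (a + b * exp r))"
        using pos by (simp add: D_def field_simps power2_eq_square)
      also have "2 / D * \<dots> = 2 / ((a + b * exp r) * (a + b * exp (- r)))"
        unfolding e using D by (simp add: field_simps)
      also have "(\<lambda>r. 2 / D * (ln (b + a * exp r) - ln (a + b * exp r))) =
          (\<lambda>r. 2 / D * ln ((b + a * exp r) / (a + b * exp r)))"
      proof
        fix r
        have "b + a * exp r > 0" "a + b * exp r > 0"
          using assms by (simp_all add: add_pos_pos)
        then show "2 / D * (ln (b + a * exp r) - ln (a + b * exp r)) =
            2 / D * ln ((b + a * exp r) / (a + b * exp r))"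
          by (subst ln_div) auto
      qed
      finally show ?thesis .
    qed
    show "((\<lambda>r. 2 / D * ln ((b + a * exp r) / (a + b * exp r))) \<longlongrightarrow> 2 / D * ln (a / b)) at_top"
    proof (intro tendsto_mult_left tendsto_ln)
      show "((\<lambda>r. (b + a * exp r) / (a + b * exp r)) \<longlongrightarrow> a / b) at_top"
        using assms by (real_asymp simp: field_simps)
    qed (use assms in auto)
    show "((\<lambda>r. 2 / D * ln ((b + a * exp r) / (a + b * exp r))) \<longlongrightarrow> 2 / D * ln (b / a)) at_bot"
    proof (intro tendsto_mult_left tendsto_ln)
      show "((\<lambda>r. (b + a * exp r) / (a + b * exp r)) \<longlongrightarrow> b / a) at_bot"
        using assms by (real_asymp simp: field_simps)
    qed (use assms in auto)
    show "0 \<le> 2 / ((a + b * exp r) * (a + b * exp (- r)))" for r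
      using assms by (simp add: add_nonneg_nonneg)
  qed auto
  also have "2 / D * ln (a / b) - 2 / D * ln (b / a) = 4 * ln (a / b) / D"
    using assms D by (simp add: ln_div field_simps)
  finally show ?thesis by (simp add: D_def)
qed

text \<open>Both factors are expanded and \<open>x\<close> is integrated first, leaving a rational
  function of exponentials in two variables. The factor 4 reflects that \<open>k0\<close> is twice
  the Bessel function.\<close>

lemma nn_integral_k0_product:
  assumes "a > 0" "b > 0" "a \<noteq> b"
  shows "(\<integral>\<^sup>+x. ennreal x * (k0 (a * x) * k0 (b * x)) \<partial>lborel) =
    ennreal (4 * ln (a / b) / (a\<^sup>2 - b\<^sup>2))"
proof -
  have "(\<integral>\<^sup>+x. ennreal x * (k0 (a * x) * k0 (b * x)) \<partial>lborel) =
      (\<integral>\<^sup>+x. \<integral>\<^sup>+p. \<integral>\<^sup>+q. ennreal x * ennreal (exp (- (a * x) * cosh p - b * x * cosh q))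
        \<partial>lborel \<partial>lborel \<partial>lborel)"
    unfolding k0_mult by (simp add: nn_integral_cmult)
  also have "\<dots> = (\<integral>\<^sup>+p. \<integral>\<^sup>+x. \<integral>\<^sup>+q. ennreal x * ennreal (exp (- (a * x) * cosh p - b * x * cosh q))
        \<partial>lborel \<partial>lborel \<partial>lborel)"
    by (rule lborel_pair.Fubini') measurable
  also have "\<dots> = (\<integral>\<^sup>+p. \<integral>\<^sup>+q. \<integral>\<^sup>+x. ennreal x * ennreal (exp (- (a * x) * cosh p - b * x * cosh q))
        \<partial>lborel \<partial>lborel \<partial>lborel)"
    by (intro nn_integral_cong lborel_pair.Fubini') measurable
  also have "\<dots> = (\<integral>\<^sup>+p. \<integral>\<^sup>+q. ennreal (1 / (a * cosh p + b * cosh q)\<^sup>2) \<partial>lborel \<partial>lborel)"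
  proof (intro nn_integral_cong)
    fix p q :: real
    have "a * cosh p + b * cosh q > 0"
      using assms by (simp add: add_pos_pos)
    from nn_integral_moment_exp[OF this]
    show "(\<integral>\<^sup>+x. ennreal x * ennreal (exp (- (a * x) * cosh p - b * x * cosh q)) \<partial>lborel) =
        ennreal (1 / (a * cosh p + b * cosh q)\<^sup>2)"
      by (simp add: algebra_simps)
  qed
  \<comment> \<open>The shift q = p + r makes the base of the square linear in exp(p) and exp(-p),
    with coefficients depending on \<open>r\<close> alone, so that the integrals over
    \<open>p\<close> and \<open>r\<close> can be done in turn.\<close>
  also have "\<dots> = (\<integral>\<^sup>+p. \<integral>\<^sup>+r. ennreal (1 / (a * cosh p + b * cosh (p + 1 * r))\<^sup>2) \<partial>lborel \<partial>lborel)"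
    by (rule nn_integral_cong, subst nn_integral_real_affine[where c = 1]) auto
  also have "\<dots> = (\<integral>\<^sup>+r. \<integral>\<^sup>+p. ennreal (1 / (a * cosh p + b * cosh (p + 1 * r))\<^sup>2) \<partial>lborel \<partial>lborel)"
    by (rule lborel_pair.Fubini') measurable
  also have "\<dots> = (\<integral>\<^sup>+r. ennreal (2 / ((a + b * exp r) * (a + b * exp (- r)))) \<partial>lborel)"
  proof (rule nn_integral_cong)
    fix r :: real
    have "1 / (a * cosh p + b * cosh (p + 1 * r))\<^sup>2 =
        4 / ((a + b * exp r) * exp p + (a + b * exp (- r)) * exp (- p))\<^sup>2" for p
    proof -
      have "a * cosh p + b * cosh (p + 1 * r) =
          ((a + b * exp r) * exp p + (a + b * exp (- r)) * exp (- p)) / 2"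
        by (simp add: cosh_def field_simps exp_add exp_diff exp_minus)
      then show ?thesis by (simp only: power_divide) simp
    qed
    then show "(\<integral>\<^sup>+p. ennreal (1 / (a * cosh p + b * cosh (p + 1 * r))\<^sup>2) \<partial>lborel) =
        ennreal (2 / ((a + b * exp r) * (a + b * exp (- r))))"
      using nn_integral_inverse_exp_square[of "a + b * exp r" "a + b * exp (- r)"] assms
      by (simp add: add_pos_pos)
  qed
  also have "\<dots> = ennreal (4 * ln (a / b) / (a\<^sup>2 - b\<^sup>2))"
    by (rule nn_integral_inverse_exp_product[OF assms])
  finally show ?thesis .
qed

text \<open>With w = tanh(u/2) the integral becomes that of w^(2k) over (-1, 1).\<close>

lemma nn_integral_tanh_power:
  "(\<integral>\<^sup>+u. ennreal (tanh (u / 2) ^ (2 * k) / (2 * (cosh (u / 2))\<^sup>2)) \<partial>lborel) =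
    ennreal (2 / real (2 * k + 1))"
proof -
  have "(\<integral>\<^sup>+u. ennreal (tanh (u / 2) ^ (2 * k) / (2 * (cosh (u / 2))\<^sup>2)) \<partial>lborel) =
    ennreal (1 ^ (2 * k + 1) / real (2 * k + 1) - (- 1) ^ (2 * k + 1) / real (2 * k + 1))"
  proof (rule nn_integral_FTC_UNIV)
    show "((\<lambda>u. tanh (u / 2) ^ (2 * k + 1) / real (2 * k + 1)) has_real_derivative
        tanh (u / 2) ^ (2 * k) / (2 * (cosh (u / 2))\<^sup>2)) (at u)" for u :: real
    proof -
      have c: "cosh (u / 2) \<noteq> 0"
        using cosh_real_pos[of "u / 2"] by linarith
      have d: "1 - (tanh (u / 2))\<^sup>2 = 1 / (cosh (u / 2))\<^sup>2"
        using c hyperbolic_pythagoras[of "u / 2"]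
        by (simp add: tanh_def divide_simps)
      have "((\<lambda>u. tanh (u / 2)) has_real_derivative (1 - (tanh (u / 2))\<^sup>2) / 2) (at u)"
        using c by (auto intro!: derivative_eq_intros)
      from DERIV_power_Suc[OF this, of "2 * k"]
      have "((\<lambda>u. tanh (u / 2) ^ (2 * k + 1)) has_real_derivative
          real (2 * k + 1) * (tanh (u / 2) ^ (2 * k) * ((1 - (tanh (u / 2))\<^sup>2) / 2))) (at u)"
        unfolding Suc_eq_plus1 by (rule DERIV_cong) simp
      then have "((\<lambda>u. tanh (u / 2) ^ (2 * k + 1) / real (2 * k + 1)) has_real_derivative
          real (2 * k + 1) * (tanh (u / 2) ^ (2 * k) * ((1 - (tanh (u / 2))\<^sup>2) / 2)) / real (2 * k + 1)) (at u)"
        by (rule DERIV_cdivide)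
      then show ?thesis
        unfolding d by (simp add: mult.commute)
    qed
    show "((\<lambda>u. tanh (u / 2) ^ (2 * k + 1) / real (2 * k + 1)) \<longlongrightarrow> 1 ^ (2 * k + 1) / real (2 * k + 1)) at_top"
    proof (intro tendsto_divide tendsto_power tendsto_const)
      show "((\<lambda>u::real. tanh (u / 2)) \<longlongrightarrow> 1) at_top"
        by (rule filterlim_compose[OF tanh_real_at_top]) real_asymp
    qed auto
    show "((\<lambda>u. tanh (u / 2) ^ (2 * k + 1) / real (2 * k + 1)) \<longlongrightarrow> (- 1) ^ (2 * k + 1) / real (2 * k + 1)) at_bot"
    proof (intro tendsto_divide tendsto_power tendsto_const)
      show "((\<lambda>u::real. tanh (u / 2)) \<longlongrightarrow> - 1) at_bot"
        by (rule filterlim_compose[OF tanh_real_at_bot]) real_asymp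
    qed auto
    show "(\<lambda>u::real. tanh (u / 2) ^ (2 * k) / (2 * (cosh (u / 2))\<^sup>2)) \<in> borel_measurable borel"
      by measurable
  qed (auto simp: power_mult)
  then show ?thesis
    by simp
qed

text \<open>The closed form ln(C/D) / (C^2 - D^2) is expanded with ln(C/D) = 2 artanh((C-D)/(C+D)).
  The argument factors as tanh p tanh q, which separates \<open>u\<close> from \<open>v\<close>.
  Nonzero \<open>u\<close> and \<open>v\<close> ensure that C and D differ.\<close>

lemma nn_integral_k0_product_series:
  assumes "u \<noteq> 0" "v \<noteq> 0"
  shows "(\<integral>\<^sup>+x. ennreal x * (k0 (2 * cosh ((u + v) / 2) * x) * k0 (2 * cosh ((u - v) / 2) * x)) \<partial>lborel) =
    (\<Sum>k. ennreal (2 / real (2 * k + 1)) *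
      (ennreal (tanh (u / 2) ^ (2 * k) / (2 * (cosh (u / 2))\<^sup>2)) *
       ennreal (tanh (v / 2) ^ (2 * k) / (2 * (cosh (v / 2))\<^sup>2))))"
proof -
  define p q where "p = u / 2" and "q = v / 2"
  define C D where "C = cosh (p + q)" and "D = cosh (p - q)"
  have nz: "sinh p \<noteq> 0" "sinh q \<noteq> 0" "cosh p > 0" "cosh q > 0"
    using assms by (auto simp: p_def q_def)
  have pos: "C > 0" "D > 0" by (simp_all add: C_def D_def)
  have CD: "C - D = 2 * (sinh p * sinh q)" "C + D = 2 * (cosh p * cosh q)"
    by (simp_all add: C_def D_def cosh_add cosh_diff)
  then have "C \<noteq> D" using nz by auto
  have sq: "C\<^sup>2 - D\<^sup>2 = 4 * (sinh p * sinh q * cosh p * cosh q)"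
    using arg_cong2[OF CD, of "(*)"] by (simp add: algebra_simps power2_eq_square)
  have z: "(C / D - 1) / (C / D + 1) = tanh p * tanh q"
  proof -
    have "(C / D - 1) / (C / D + 1) = (C - D) / (C + D)"
      using pos by (simp add: divide_simps)
    then show ?thesis by (simp add: CD tanh_def)
  qed
  \<comment> \<open>One factor tanh p tanh q of the odd power cancels sinh p sinh q in C^2 - D^2.
    Only even powers remain, so all terms are nonnegative and the series passes to
    \<open>ennreal\<close>.\<close>
  have term_eq: "2 * (tanh p * tanh q) ^ (2 * k + 1) / real (2 * k + 1) / (C\<^sup>2 - D\<^sup>2) =
      2 / real (2 * k + 1) * (tanh p ^ (2 * k) / (2 * (cosh p)\<^sup>2) * (tanh q ^ (2 * k) / (2 * (cosh q)\<^sup>2)))" for k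
  proof -
    have "2 * (tanh p * tanh q) ^ (2 * k + 1) / real (2 * k + 1) / (C\<^sup>2 - D\<^sup>2) =
        2 / real (2 * k + 1) * (tanh p ^ (2 * k) * tanh q ^ (2 * k) * (tanh p * tanh q / (C\<^sup>2 - D\<^sup>2)))"
      by (simp add: power_mult_distrib)
    also have "tanh p * tanh q / (C\<^sup>2 - D\<^sup>2) = 1 / (2 * (cosh p)\<^sup>2) * (1 / (2 * (cosh q)\<^sup>2))"
      unfolding sq using nz by (simp add: tanh_def power2_eq_square)
    finally show ?thesis by simp
  qed
  have "(\<lambda>k. 2 * (tanh p * tanh q) ^ (2 * k + 1) / real (2 * k + 1) / (C\<^sup>2 - D\<^sup>2)) sums
      (ln (C / D) / (C\<^sup>2 - D\<^sup>2))"
    using ln_series_quadratic[of "C / D"] pos unfolding z by (intro sums_divide) auto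
  then have sums: "(\<lambda>k. 2 / real (2 * k + 1) * (tanh p ^ (2 * k) / (2 * (cosh p)\<^sup>2) *
      (tanh q ^ (2 * k) / (2 * (cosh q)\<^sup>2)))) sums (ln (C / D) / (C\<^sup>2 - D\<^sup>2))"
    unfolding term_eq .
  have "(\<integral>\<^sup>+x. ennreal x * (k0 (2 * C * x) * k0 (2 * D * x)) \<partial>lborel) =
      ennreal (4 * ln (2 * C / (2 * D)) / ((2 * C)\<^sup>2 - (2 * D)\<^sup>2))"
    using pos \<open>C \<noteq> D\<close> by (intro nn_integral_k0_product) auto
  also have "4 * ln (2 * C / (2 * D)) / ((2 * C)\<^sup>2 - (2 * D)\<^sup>2) = ln (C / D) / (C\<^sup>2 - D\<^sup>2)"
  proof -
    have "(2 * C)\<^sup>2 - (2 * D)\<^sup>2 = 4 * (C\<^sup>2 - D\<^sup>2)"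
      by (simp add: power2_eq_square)
    then show ?thesis
      by (simp only: mult_divide_mult_cancel_left_if) simp
  qed
  also have "ennreal \<dots> = (\<Sum>k. ennreal (2 / real (2 * k + 1) * (tanh p ^ (2 * k) / (2 * (cosh p)\<^sup>2) *
      (tanh q ^ (2 * k) / (2 * (cosh q)\<^sup>2)))))"
    using sums by (intro suminf_ennreal_eq[symmetric]) (auto simp: power_mult)
  also have "\<dots> = (\<Sum>k. ennreal (2 / real (2 * k + 1)) *
      (ennreal (tanh p ^ (2 * k) / (2 * (cosh p)\<^sup>2)) * ennreal (tanh q ^ (2 * k) / (2 * (cosh q)\<^sup>2))))"
    by (intro suminf_cong, subst ennreal_mult, simp, simp add: power_mult, subst ennreal_mult)
       (simp_all add: power_mult)
  finally show ?thesis
    by (simp add: C_def D_def p_def q_def add_divide_distrib diff_divide_distrib)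
qed

text \<open>Squaring the formula for \<open>k0 x * k0 x\<close> reduces the fourth power to products
  of two values of \<open>k0\<close>. The factor 16 is 2^4, one 2 for each factor
  \<open>k0\<close>.\<close>

lemma k0_fourth_moment:
  "(\<integral>\<^sup>+x. ennreal x * k0 x ^ 4 \<partial>lborel) = 16 * (\<Sum>k. ennreal (1 / real (2 * k + 1) ^ 3))"
proof -
  define h where "h k u = ennreal (tanh (u / 2) ^ (2 * k) / (2 * (cosh (u / 2))\<^sup>2))" for k :: nat and u :: real
  have [measurable]: "h k \<in> borel_measurable borel" for k
    unfolding h_def by measurable
  define J where "J a b = (\<integral>\<^sup>+x. ennreal x * (k0 (2 * a * x) * k0 (2 * b * x)) \<partial>lborel)" for a b :: real
  have [measurable]: "(\<lambda>(a, b). J a b) \<in> borel_measurable (borel \<Otimes>\<^sub>M borel)"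
    unfolding J_def by measurable
  have sq: "k0 x ^ 4 = 4 * (\<integral>\<^sup>+s. \<integral>\<^sup>+t. k0 (2 * cosh s * x) * k0 (2 * cosh t * x) \<partial>lborel \<partial>lborel)" for x
  proof -
    have "k0 x ^ 4 = (k0 x * k0 x) * (k0 x * k0 x)"
      by (simp add: eval_nat_numeral mult.assoc)
    also have "\<dots> = 4 * ((\<integral>\<^sup>+s. k0 (2 * x * cosh s) \<partial>lborel) * (\<integral>\<^sup>+t. k0 (2 * x * cosh t) \<partial>lborel))"
      unfolding k0_square by (simp add: mult_ac)
    also have "\<dots> = 4 * (\<integral>\<^sup>+s. \<integral>\<^sup>+t. k0 (2 * cosh s * x) * k0 (2 * cosh t * x) \<partial>lborel \<partial>lborel)"
      by (simp add: nn_integral_multc nn_integral_cmult mult_ac)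
    finally show ?thesis .
  qed
  have "(\<integral>\<^sup>+x. ennreal x * k0 x ^ 4 \<partial>lborel) =
      4 * (\<integral>\<^sup>+x. \<integral>\<^sup>+s. \<integral>\<^sup>+t. ennreal x * (k0 (2 * cosh s * x) * k0 (2 * cosh t * x)) \<partial>lborel \<partial>lborel \<partial>lborel)"
    unfolding sq by (simp add: nn_integral_cmult mult.left_commute[of _ 4])
  also have "(\<integral>\<^sup>+x. \<integral>\<^sup>+s. \<integral>\<^sup>+t. ennreal x * (k0 (2 * cosh s * x) * k0 (2 * cosh t * x)) \<partial>lborel \<partial>lborel \<partial>lborel) =
      (\<integral>\<^sup>+s. \<integral>\<^sup>+x. \<integral>\<^sup>+t. ennreal x * (k0 (2 * cosh s * x) * k0 (2 * cosh t * x)) \<partial>lborel \<partial>lborel \<partial>lborel)"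
    by (rule lborel_pair.Fubini') measurable
  also have "\<dots> = (\<integral>\<^sup>+s. \<integral>\<^sup>+t. J (cosh s) (cosh t) \<partial>lborel \<partial>lborel)"
    unfolding J_def by (intro nn_integral_cong lborel_pair.Fubini') measurable
  \<comment> \<open>\<open>s\<close> and \<open>t\<close> are rewritten through \<open>s + t\<close>
    and \<open>s - t\<close>, so that the rotation can be read backwards; it absorbs one of the two
    factors 2.\<close>
  also have "4 * \<dots> = 2 * (2 * (\<integral>\<^sup>+s. \<integral>\<^sup>+t. J (cosh (((s + t) + (s - t)) / 2)) (cosh (((s + t) - (s - t)) / 2)) \<partial>lborel \<partial>lborel))"
    by (simp add: mult.assoc[symmetric])
  also have "2 * (\<integral>\<^sup>+s. \<integral>\<^sup>+t. J (cosh (((s + t) + (s - t)) / 2)) (cosh (((s + t) - (s - t)) / 2)) \<partial>lborel \<partial>lborel)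
      = (\<integral>\<^sup>+u. \<integral>\<^sup>+v. J (cosh ((u + v) / 2)) (cosh ((u - v) / 2)) \<partial>lborel \<partial>lborel)"
    by (rule nn_integral_rotate[symmetric]) measurable
  also have "\<dots> = (\<integral>\<^sup>+u. \<integral>\<^sup>+v. (\<Sum>k. ennreal (2 / real (2 * k + 1)) * (h k u * h k v)) \<partial>lborel \<partial>lborel)"
  \<comment> \<open>The series is available only for nonzero \<open>u\<close> and \<open>v\<close>;
    the excluded points form null sets.\<close>
  proof (rule nn_integral_cong_AE, use AE_lborel_singleton[of "0::real"] in eventually_elim)
    fix u :: real assume u: "u \<noteq> 0"
    show "(\<integral>\<^sup>+v. J (cosh ((u + v) / 2)) (cosh ((u - v) / 2)) \<partial>lborel) =
       (\<integral>\<^sup>+v. (\<Sum>k. ennreal (2 / real (2 * k + 1)) * (h k u * h k v)) \<partial>lborel)"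
    proof (rule nn_integral_cong_AE, use AE_lborel_singleton[of "0::real"] in eventually_elim)
      fix v :: real assume "v \<noteq> 0"
      with u show "J (cosh ((u + v) / 2)) (cosh ((u - v) / 2)) = (\<Sum>k. ennreal (2 / real (2 * k + 1)) * (h k u * h k v))"
        unfolding J_def h_def by (rule nn_integral_k0_product_series)
    qed
  qed
  also have "\<dots> = (\<Sum>k. ennreal (2 / real (2 * k + 1)) * ((\<integral>\<^sup>+u. h k u \<partial>lborel) * (\<integral>\<^sup>+v. h k v \<partial>lborel)))"
    by (simp add: nn_integral_suminf nn_integral_cmult nn_integral_multc)
  also have "\<dots> = (\<Sum>k. 8 * ennreal (1 / real (2 * k + 1) ^ 3))"
  proof (rule suminf_cong)
    fix k
    have "2 / real (2 * k + 1) * (2 / real (2 * k + 1) * (2 / real (2 * k + 1))) = 8 * (1 / real (2 * k + 1) ^ 3)"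
      by (simp add: power3_eq_cube)
    then show "ennreal (2 / real (2 * k + 1)) * ((\<integral>\<^sup>+u. h k u \<partial>lborel) * (\<integral>\<^sup>+v. h k v \<partial>lborel)) = 
        8 * ennreal (1 / real (2 * k + 1) ^ 3)"
      unfolding h_def nn_integral_tanh_power by (simp flip: ennreal_mult ennreal_numeral)
  qed
  also have "\<dots> = 8 * (\<Sum>k. ennreal (1 / real (2 * k + 1) ^ 3))"
    by (rule ennreal_suminf_cmult)
  finally show ?thesis
    by (simp add: mult.assoc[symmetric])
qed

section \<open>The sum over odd cubes\<close>

lemma summable_inverse_cubes: "summable (\<lambda>k. 1 / real (Suc k) ^ 3)"
  using inverse_power_summable[of 3, where ?'a = real]
  by (subst summable_Suc_iff) (simp add: inverse_eq_divide)

text \<open>Terms are grouped in pairs; the even member of each pair is one eighth of a term of the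
  full series, so removing them leaves 1 - 1/8 of \<open>zeta3\<close>.\<close>

lemma sums_inverse_odd_cubes: "(\<lambda>k. 1 / real (2 * k + 1) ^ 3) sums (7 / 8 * zeta3)"
proof -
  define f where "f k = 1 / real (Suc k) ^ 3" for k
  have f: "f sums zeta3"
    unfolding f_def zeta3_def using summable_inverse_cubes by (rule summable_sums)
  have "(\<lambda>k. sum f {k * 2..<k * 2 + 2}) sums zeta3"
    by (rule sums_group[OF f]) auto
  then have "(\<lambda>k. f (2 * k) + f (2 * k + 1)) sums zeta3"
    by (simp add: mult.commute eval_nat_numeral)
  moreover have "(\<lambda>k. f k / 8) sums (zeta3 / 8)"
    by (intro sums_divide f)
  ultimately have "(\<lambda>k. f (2 * k) + f (2 * k + 1) - f k / 8) sums (zeta3 - zeta3 / 8)"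
    by (rule sums_diff)
  also have "(\<lambda>k. f (2 * k) + f (2 * k + 1) - f k / 8) = (\<lambda>k. 1 / real (2 * k + 1) ^ 3)"
  proof
    fix k
    have "real (Suc (2 * k + 1)) = 2 * real (Suc k)" by simp
    then have "f (2 * k + 1) = f k / 8"
      unfolding f_def by (simp only: power_mult_distrib) simp
    then show "f (2 * k) + f (2 * k + 1) - f k / 8 = 1 / real (2 * k + 1) ^ 3"
      by (simp add: f_def)
  qed
  finally show ?thesis by simp
qed

section \<open>The recurrence of the Domb numbers\<close>

text \<open>
  The hypotheses are the ladder relations between the products \<open>y\<^sup>4\<^sup>-\<^sup>j (\<theta>y)\<^sup>j\<close> for a solution
  of \<open>\<theta>\<^sup>2y = X y\<close>. Power series coefficients satisfy them with \<open>N = n + 2\<close>, and Bessel moments,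
  after scaling by powers of \<open>- 1 / 2\<close>, with \<open>N = - (n + 1)\<close>.
\<close>
lemma domb_recurrence_elimination:
  fixes N a2 a1 a0 :: real
  assumes "N * a2 = 4 * g1" "(N - 1) * a1 = 4 * g1'" "(N - 2) * a0 = 4 * g1''"
    and "N * g1 = 3 * g2 + a1" "(N - 1) * g1' = 3 * g2' + a0"
    and "N * g2 = 2 * g3 + 2 * g1'" "(N - 1) * g2' = 2 * g3' + 2 * g1''"
    and "N * g3 = g4 + 3 * g2'" "N * g4 = 4 * g3'"
  shows "N ^ 5 * a2 - 4 * (2 * N - 1) * (5 * N\<^sup>2 - 5 * N + 2) / 2 * a1 + 64 * (N - 1) * a0 = 0"
proof -
  \<comment> \<open>The first eight relations are solved in order for the \<open>g\<close> variables
    in terms of \<open>a2\<close>, \<open>a1\<close>, \<open>a0\<close>; the ninth then becomes the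
    recurrence.\<close>
  have g1: "g1 = N * a2 / 4" "g1' = (N - 1) * a1 / 4" "g1'' = (N - 2) * a0 / 4"
    using assms(1-3) by auto
  have g2: "g2 = (N * g1 - a1) / 3" "g2' = ((N - 1) * g1' - a0) / 3"
    using assms(4-5) by auto
  have g3: "g3 = (N * g2 - 2 * g1') / 2" "g3' = ((N - 1) * g2' - 2 * g1'') / 2"
    using assms(6-7) by auto
  have g4: "g4 = N * g3 - 3 * g2'" using assms(8) by simp
  show ?thesis
    using assms(9) unfolding g4 g3 g2 g1 
    by (simp add: field_simps) algebra
qed

text \<open>The Euler operator X d/dX.\<close>

definition fps_theta :: "real fps \<Rightarrow> real fps" where
  "fps_theta f = fps_X * fps_deriv f"

lemma fps_theta_nth: "fps_nth (fps_theta f) n = real n * fps_nth f n"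
  by (cases n) (simp_all add: fps_theta_def)

text \<open>This is \<open>I\<^sub>0(2 \<surd>X)\<close>, so that the Bessel equation becomes \<open>\<theta>\<^sup>2y = X y\<close>.\<close>
definition I0_fps :: "real fps" where
  "I0_fps = Abs_fps (\<lambda>n. 1 / (fact n)\<^sup>2)"

lemma fps_theta_theta_I0: "fps_theta (fps_theta I0_fps) = fps_X * I0_fps"
proof (rule fps_ext)
  fix n show "fps_nth (fps_theta (fps_theta I0_fps)) n = fps_nth (fps_X * I0_fps) n"
    by (cases n) (simp_all add: fps_theta_nth I0_fps_def power2_eq_square divide_simps)
qed

lemma fps_theta_power: "fps_theta (f ^ n) = of_nat n * f ^ (n - 1) * fps_theta f"
  by (simp add: fps_theta_def fps_deriv_power mult_ac flip: fps_of_nat)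

lemma fps_theta_mult: "fps_theta (f * g) = fps_theta f * g + f * fps_theta g"
  by (simp add: fps_theta_def algebra_simps)

text \<open>Product rule plus the Bessel equation: each derivative trades one factor for its
  neighbour. Truncated exponents at \<open>i = 0\<close> or \<open>j = 0\<close> are harmless
  because their coefficient is 0.\<close>

lemma fps_theta_I0_product:
  "fps_theta (I0_fps ^ i * fps_theta I0_fps ^ j) =
     of_nat i * (I0_fps ^ (i - 1) * fps_theta I0_fps ^ (j + 1))
     + of_nat j * (fps_X * (I0_fps ^ (i + 1) * fps_theta I0_fps ^ (j - 1)))"
  by (simp add: fps_theta_mult fps_theta_power fps_theta_theta_I0 algebra_simps)

text \<open>Comparison of coefficients at \<open>Suc n\<close>; the factor \<open>fps_X\<close>
  lowers the index in the last term.\<close>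

lemma I0_product_nth:
  "real (Suc n) * fps_nth (I0_fps ^ i * fps_theta I0_fps ^ j) (Suc n) =
     real i * fps_nth (I0_fps ^ (i - 1) * fps_theta I0_fps ^ (j + 1)) (Suc n)
     + real j * fps_nth (I0_fps ^ (i + 1) * fps_theta I0_fps ^ (j - 1)) n"
proof -
  have c: "of_nat k = fps_const (real k)" for k :: nat by (simp add: fps_of_nat)
  show ?thesis
    using arg_cong[OF fps_theta_I0_product[of i j], of "\<lambda>f. fps_nth f (Suc n)"]
    unfolding fps_theta_nth c by simp
qed

text \<open>The convolution yields the sum of squared binomials, a case of Vandermonde's
  identity.\<close>

lemma I0_squared_nth: "fps_nth (I0_fps ^ 2) n = real ((2 * n) choose n) / (fact n)\<^sup>2"
proof -
  have "fps_nth (I0_fps ^ 2) n = (\<Sum>k\<le>n. (real (n choose k))\<^sup>2 / (fact n)\<^sup>2)"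
    by (auto simp: power2_eq_square fps_mult_nth I0_fps_def binomial_fact field_simps atMost_atLeast0 
             intro!: sum.cong)
  also have "\<dots> = real (\<Sum>k\<le>n. (n choose k)\<^sup>2) / (fact n)\<^sup>2"
    by (simp add: sum_divide_distrib)
  finally show ?thesis by (simp only: choose_square_sum)
qed

text \<open>A convolution of the square with itself; \<open>(n choose k)\<^sup>2\<close> accounts
  for the quotient of squared factorials.\<close>

lemma I0_fourth_nth: "fps_nth (I0_fps ^ 4) n = A_seq n / (fact n)\<^sup>2"
proof -
  have "fps_nth (I0_fps ^ 4) n = fps_nth (I0_fps ^ 2 * I0_fps ^ 2) n"
    by (simp flip: power_add)
  also have "\<dots> = (\<Sum>k=0..n. fps_nth (I0_fps ^ 2) k * fps_nth (I0_fps ^ 2) (n - k))"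
    by (rule fps_mult_nth)
  also have "\<dots> = A_seq n / (fact n)\<^sup>2"
    unfolding A_seq_def sum_divide_distrib I0_squared_nth
  proof (rule sum.cong)
    fix k assume "k \<in> {0..n}"
    then obtain m where n: "n = k + m"
      by (auto simp: le_iff_add)
    have e: "n - k = m" "2 * n - 2 * k = 2 * m"
      by (simp_all add: n)
    have "real (n choose k) = fact n / (fact k * fact m)"
      using binomial_fact[of k n] by (simp add: n)
    then show "real ((2 * k) choose k) / (fact k)\<^sup>2 * (real ((2 * (n - k)) choose (n - k)) / (fact (n - k))\<^sup>2)
      = real ((n choose k)\<^sup>2 * ((2 * k) choose k) * ((2 * n - 2 * k) choose (n - k))) / (fact n)\<^sup>2"
      unfolding e by (simp add: power2_eq_square)
  qed simp
  finally show ?thesis .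
qed

text \<open>Multiplication by the square of (n+1)! clears the factorials, turning the fifth and
  first powers of the outer coefficients into cubes.\<close>

lemma domb_rescale:
  fixes a a1 a2 :: real
  assumes "(real n + 2) ^ 5 * (a2 / (fact (n + 2))\<^sup>2)
     - 2 * (2 * real n + 3) * (5 * (real n)\<^sup>2 + 15 * real n + 12) * (a1 / (fact (n + 1))\<^sup>2)
     + 64 * (real n + 1) * (a / (fact n)\<^sup>2) = 0"
  shows "(real n + 2) ^ 3 * a2
     - 2 * (2 * real n + 3) * (5 * (real n)\<^sup>2 + 15 * real n + 12) * a1
     + 64 * (real n + 1) ^ 3 * a = 0"
proof -
  define F where "F = (fact n :: real)"
  define P where "P = 2 * (2 * real n + 3) * (5 * (real n)\<^sup>2 + 15 * real n + 12)"
  have f: "(fact (n + 1) :: real) = (real n + 1) * F"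
       "(fact (n + 2) :: real) = (real n + 2) * ((real n + 1) * F)"
    by (simp_all add: F_def field_simps)
  have *: "(real n + 2) ^ 5 * (a2 / ((real n + 2) * ((real n + 1) * F))\<^sup>2)
     - P * (a1 / ((real n + 1) * F)\<^sup>2) + 64 * (real n + 1) * (a / F\<^sup>2) = 0"
    using assms unfolding f F_def[symmetric] P_def[symmetric] .
  define x y where "x = real n + 1" and "y = real n + 2"
  have "F \<noteq> 0" "x \<noteq> 0" "y \<noteq> 0" by (simp_all add: F_def x_def y_def)
  have *: "y ^ 5 * (a2 / (y * (x * F))\<^sup>2) - P * (a1 / (x * F)\<^sup>2) + 64 * x * (a / F\<^sup>2) = 0"
    using * by (simp add: x_def y_def)
  have "y ^ 3 * a2 - P * a1 + 64 * x ^ 3 * a = (x * F)\<^sup>2 *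
      (y ^ 5 * (a2 / (y * (x * F))\<^sup>2) - P * (a1 / (x * F)\<^sup>2) + 64 * x * (a / F\<^sup>2))"
    using \<open>F \<noteq> 0\<close> \<open>x \<noteq> 0\<close> \<open>y \<noteq> 0\<close>
    by (simp add: field_simps power2_eq_square eval_nat_numeral)
  also have "\<dots> = 0"
    by (simp only: * mult_zero_right)
  finally show ?thesis
    unfolding P_def x_def y_def .
qed

lemma A_seq_recurrence:
  "(real n + 2) ^ 3 * A_seq (n + 2)
     - 2 * (2 * real n + 3) * (5 * (real n)\<^sup>2 + 15 * real n + 12) * A_seq (n + 1)
     + 64 * (real n + 1) ^ 3 * A_seq n = 0"
proof -
  define g where "g j m = fps_nth (I0_fps ^ (4 - j) * fps_theta I0_fps ^ j) m" for j m
  have rel: "real (Suc m) * g j (Suc m) = real (4 - j) * g (j + 1) (Suc m) + real j * g (j - 1) m"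
    if "j \<le> 4" for j m
  proof -
    \<comment> \<open>At \<open>j = 0\<close> truncated subtraction spoils the second equation, but
      that term carries the factor \<open>real j\<close>.\<close>
    have "4 - j - 1 = 4 - (j + 1)" "j = 0 \<or> 4 - j + 1 = 4 - (j - 1)"
      using that by auto
    then show ?thesis
      using I0_product_nth[of m "4 - j" j] by (auto simp only: g_def)
  qed
  \<comment> \<open>\<open>rel\<close> covers only successor indices. At index 0, needed when
    \<open>n = 0\<close>, both sides vanish.\<close>
  have g0: "real m * g 0 m = 4 * g 1 m" for m
    by (cases m) (use rel[of 0] in \<open>auto simp: g_def fps_theta_nth\<close>)
  have a: "g 0 m = A_seq m / (fact m)\<^sup>2" for m
    by (simp add: g_def I0_fourth_nth)
  have "(real n + 2) ^ 5 * g 0 (n + 2) 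
     - 4 * (2 * (real n + 2) - 1) * (5 * (real n + 2)\<^sup>2 - 5 * (real n + 2) + 2) / 2 * g 0 (n + 1)
     + 64 * ((real n + 2) - 1) * g 0 n = 0"
    by (rule domb_recurrence_elimination[where ?g1.0 = "g 1 (n+2)" and ?g1' = "g 1 (n+1)" 
          and ?g1'' = "g 1 n" and ?g2.0 = "g 2 (n+2)" and ?g2' = "g 2 (n+1)"
          and ?g3.0 = "g 3 (n+2)" and ?g3' = "g 3 (n+1)" and ?g4.0 = "g 4 (n+2)"])
       (use g0[of "n+2"] g0[of "n+1"] g0[of n] rel[of 1 "n+1"] rel[of 1 n] rel[of 2 "n+1"] rel[of 2 n] 
            rel[of 3 "n+1"] rel[of 4 "n+1"] in \<open>simp_all add: add_ac eval_nat_numeral\<close>)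
  also have "4 * (2 * (real n + 2) - 1) * (5 * (real n + 2)\<^sup>2 - 5 * (real n + 2) + 2) / 2
    = 2 * (2 * real n + 3) * (5 * (real n)\<^sup>2 + 15 * real n + 12)"
    by (simp add: algebra_simps power2_eq_square)
  also have "(real n + 2) - 1 = real n + 1" by simp
  finally show ?thesis
    unfolding a by (rule domb_rescale)
qed

lemma A_seq_0: "A_seq 0 = 1" and A_seq_1: "A_seq 1 = 4"
  by (simp_all add: A_seq_def)

section \<open>Derivatives and bounds of Bessel functions\<close>

lemma power_le_fact_mult_exp:
  fixes x :: real
  assumes "x \<ge> 0"
  shows "x ^ n \<le> fact n * exp x"
proof -
  obtain t where t: "exp x = (\<Sum>m<Suc n. x ^ m / fact m) + exp t / fact (Suc n) * x ^ Suc n"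
    using Maclaurin_exp_le[of x "Suc n"] by blast
  have "x ^ n / fact n \<le> (\<Sum>m<Suc n. x ^ m / fact m)"
    by (rule member_le_sum) (use assms in auto)
  also have "\<dots> \<le> exp x"
    unfolding t using assms by simp
  finally show ?thesis
    by (simp add: field_simps)
qed

lemma abs_exp_minus_linear_le:
  fixes y :: real
  shows "\<bar>exp y - 1 - y\<bar> \<le> y\<^sup>2 / 2 * exp \<bar>y\<bar>"
proof -
  obtain t where t: "\<bar>t\<bar> \<le> \<bar>y\<bar>" "exp y = (\<Sum>m<2. y ^ m / fact m) + exp t / fact 2 * y ^ 2"
    using Maclaurin_exp_le[of y 2] by blast
  then have "exp y - 1 - y = y\<^sup>2 / 2 * exp t"
    by (simp add: eval_nat_numeral)
  moreover have "y\<^sup>2 / 2 * exp t \<le> y\<^sup>2 / 2 * exp \<bar>y\<bar>"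
    using t(1) by (intro mult_left_mono) auto
  moreover have "0 \<le> y\<^sup>2 / 2 * exp t"
    by simp
  ultimately show ?thesis
    by linarith
qed

lemma cosh_ge_self:
  fixes t :: real
  assumes "t \<ge> 0"
  shows "t \<le> cosh t"
proof -
  \<comment> \<open>This is (t-1)^2 + 1 >= 0 rearranged.\<close>
  have "t * 2 \<le> 1 + t + t\<^sup>2 / 2"
    using sum_squares_ge_zero[of "t - 1" 1] by (simp add: power2_eq_square algebra_simps)
  also have "\<dots> \<le> exp t"
    by (rule exp_lower_Taylor_quadratic[OF assms])
  also have "\<dots> \<le> 2 * cosh t"
    by (simp add: cosh_def)
  finally show ?thesis by simp
qed

lemma set_integrable_exp_neg:
  fixes c :: real
  assumes "c > 0"
  shows "set_integrable lborel {0..} (\<lambda>t. exp (- c * t))"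
    and "(LINT t:{0..}|lborel. exp (- c * t)) = 1 / c"
proof -
  have "(\<integral>\<^sup>+t. ennreal (exp (- c * t)) * indicator {0..} t \<partial>lborel) = ennreal (0 - (- exp (- c * 0) / c))"
  proof (rule nn_integral_FTC_atLeast)
    show "((\<lambda>t. - exp (- c * t) / c) has_real_derivative exp (- c * t)) (at t)" for t
      using assms by (auto intro!: derivative_eq_intros)
    show "((\<lambda>t. - exp (- c * t) / c) \<longlongrightarrow> 0) at_top"
      using assms by real_asymp
  qed auto
  also have "(\<integral>\<^sup>+t. ennreal (exp (- c * t)) * indicator {0..} t \<partial>lborel) =
      (\<integral>\<^sup>+t. ennreal (indicator {0..} t *\<^sub>R exp (- c * t)) \<partial>lborel)"
    by (rule nn_integral_cong) (auto simp: indicator_def)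
  finally have nn: "(\<integral>\<^sup>+t. ennreal (indicator {0..} t *\<^sub>R exp (- c * t)) \<partial>lborel) = ennreal (1 / c)"
    by simp
  then show "set_integrable lborel {0..} (\<lambda>t. exp (- c * t))"
    unfolding set_integrable_def by (intro integrableI_nn_integral_finite) auto
  show "(LINT t:{0..}|lborel. exp (- c * t)) = 1 / c"
    unfolding set_lebesgue_integral_def
    by (subst integral_eq_nn_integral) (use nn assms in auto)
qed

lemma set_LINT_Ici_eq_Ioi:
  fixes f :: "real \<Rightarrow> real"
  shows "(LINT t:{a..}|lborel. f t) = (LINT t:{a<..}|lborel. f t)"
  by (rule set_integral_discrete_difference[of "{a}"]) auto

text \<open>The ends enter only through limits, so antiderivatives built from \<open>K0\<close>,
  which is singular at 0, are admissible.\<close>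

lemma set_LINT_FTC_Ioi:
  fixes f F :: "real \<Rightarrow> real"
  assumes "\<And>x. x > 0 \<Longrightarrow> (F has_real_derivative f x) (at x)"
    and "\<And>x. x > 0 \<Longrightarrow> isCont f x"
    and "set_integrable lborel {0<..} f"
    and "(F \<longlongrightarrow> A) (at_right 0)" "(F \<longlongrightarrow> B) at_top"
  shows "(LINT x:{0<..}|lborel. f x) = B - A"
proof -
  have e: "einterval 0 \<infinity> = {0::real<..}"
    using einterval_eq_Ici[of 0] by (simp add: zero_ereal_def)
  have l: "((F \<circ> real_of_ereal) \<longlongrightarrow> A) (at_right 0)"
    using ereal_tendsto_simps1(2)[of F A 0] assms by (simp add: zero_ereal_def)
  have "(LBINT x=ereal 0..\<infinity>. f x) = B - A"
    by (rule interval_integral_FTC_integrable[where F = F])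
       (use assms e l in \<open>auto simp: ereal_tendsto_simps1
          simp flip: has_real_derivative_iff_has_vector_derivative\<close>)
  then show ?thesis
    by (simp only: interval_integral_to_infinity_eq)
qed

text \<open>For positive \<open>x\<close> this is (-1)^n times the \<open>n\<close>-th derivative of
  \<open>K0\<close>, as differentiation under the integral shows.\<close>

definition KI :: "nat \<Rightarrow> real \<Rightarrow> real" where
  "KI n x = (LINT t:{0..}|lborel. cosh t ^ n * exp (- x * cosh t))"

lemma K0_eq_KI: "K0 = KI 0"
  by (simp add: fun_eq_iff K0_def KI_def)

lemma KI_measurable [measurable]: "KI n \<in> borel_measurable borel"
  unfolding KI_def set_lebesgue_integral_def by measurable

lemma KI_nonneg: "KI n x \<ge> 0"
  unfolding KI_def set_lebesgue_integral_def
  by (intro integral_nonneg_AE AE_I2) (auto simp: indicator_def)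

text \<open>Half of the exponent pays for the power of cosh, and the other half gives decay because
  cosh t >= t.\<close>

lemma set_integrable_KI:
  fixes x :: real
  assumes "x > 0"
  shows "set_integrable lborel {0..} (\<lambda>t. cosh t ^ n * exp (- x * cosh t))"
proof (rule set_integrable_bound)
  show "set_integrable lborel {0..} (\<lambda>t. fact n / (x / 2) ^ n * exp (- (x / 2) * t))"
    using set_integrable_exp_neg(1)[of "x / 2"] assms by (intro set_integrable_mult_right) auto
  show "set_borel_measurable lborel {0..} (\<lambda>t. cosh t ^ n * exp (- x * cosh t))"
    unfolding set_borel_measurable_def by measurable
  show "AE t in lborel. t \<in> {0..} \<longrightarrow> norm (cosh t ^ n * exp (- x * cosh t)) \<le>
      norm (fact n / (x / 2) ^ n * exp (- (x / 2) * t))"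
  proof (intro AE_I2 impI)
    fix t :: real assume "t \<in> {0..}"
    have "(x / 2 * cosh t) ^ n \<le> fact n * exp (x / 2 * cosh t)"
      using assms by (intro power_le_fact_mult_exp) auto
    then have "cosh t ^ n \<le> fact n / (x / 2) ^ n * exp (x / 2 * cosh t)"
      using assms unfolding power_mult_distrib by (simp add: pos_le_divide_eq mult.commute)
    then have "cosh t ^ n * exp (- x * cosh t) \<le>
        fact n / (x / 2) ^ n * exp (x / 2 * cosh t) * exp (- x * cosh t)"
      by (rule mult_right_mono) simp
    also have "\<dots> = fact n / (x / 2) ^ n * exp (- (x / 2) * cosh t)"
      by (simp add: mult.assoc flip: exp_add)
    also have "\<dots> \<le> fact n / (x / 2) ^ n * exp (- (x / 2) * t)"
      using assms cosh_ge_self[of t] \<open>t \<in> {0..}\<close> by (intro mult_left_mono) auto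
    finally show "norm (cosh t ^ n * exp (- x * cosh t)) \<le> norm (fact n / (x / 2) ^ n * exp (- (x / 2) * t))"
      using assms by simp
  qed
qed

text \<open>Quantitative differentiation under the integral. Since \<open>h\<close> is at most x/2
  in size, the Taylor remainder uses up at most half of the decay, which explains the argument
  \<open>x / 2\<close> on the right.\<close>

lemma KI_linear_approx:
  assumes "x > 0" "\<bar>h\<bar> \<le> x / 2"
  shows "\<bar>KI n (x + h) - KI n x + h * KI (Suc n) x\<bar> \<le> h\<^sup>2 / 2 * KI (n + 2) (x / 2)"
proof -
  define f where "f m y t = cosh t ^ m * exp (- y * cosh t)" for m and y t :: real
  have int: "set_integrable lborel {0..} (f m y)" if "y > 0" for m y
    using set_integrable_KI[OF that, of m] unfolding f_def .
  have KI_f: "KI m y = (LINT t:{0..}|lborel. f m y t)" for m y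
    unfolding KI_def f_def ..
  have pos: "x + h > 0" "x / 2 > 0" using assms by auto
  let ?g = "\<lambda>t. f n (x + h) t - f n x t + h * f (Suc n) x t"
  note diff = set_integral_diff[OF int[OF pos(1), of n] int[OF assms(1), of n]]
  note add = set_integral_add[OF diff(1) set_integrable_mult_right[OF int[OF assms(1), of "Suc n"], of h]]
  note ig = add(1)
  have pt: "\<bar>?g t\<bar> \<le> h\<^sup>2 / 2 * f (n + 2) (x / 2) t" for t
  proof -
    have "exp (- (x + h) * cosh t) = exp (- x * cosh t) * exp (- h * cosh t)"
      by (simp add: algebra_simps flip: exp_add)
    then have "?g t = f n x t * (exp (- h * cosh t) - 1 - (- h * cosh t))"
      by (simp add: f_def algebra_simps)
    also have "\<bar>\<dots>\<bar> \<le> f n x t * ((- h * cosh t)\<^sup>2 / 2 * exp \<bar>- h * cosh t\<bar>)"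
      unfolding abs_mult[of "f n x t"] by (rule mult_mono[OF _ abs_exp_minus_linear_le]) (auto simp: f_def)
    also have "\<dots> \<le> f n x t * ((- h * cosh t)\<^sup>2 / 2 * exp (x / 2 * cosh t))"
      using assms by (intro mult_left_mono) (auto simp: f_def abs_mult)
    also have "\<dots> = h\<^sup>2 / 2 * (cosh t ^ (n + 2) * (exp (- x * cosh t) * exp (x / 2 * cosh t)))"
      by (simp add: f_def power_mult_distrib power_add power2_eq_square mult_ac)
    also have "exp (- x * cosh t) * exp (x / 2 * cosh t) = exp (- (x / 2) * cosh t)"
      by (simp add: field_simps flip: exp_add)
    finally show ?thesis by (simp add: f_def)
  qed
  have "KI n (x + h) - KI n x + h * KI (Suc n) x = (LINT t:{0..}|lborel. ?g t)"
    unfolding add(2) diff(2) set_integral_mult_right KI_f ..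
  also have "\<bar>\<dots>\<bar> \<le> (LINT t:{0..}|lborel. \<bar>?g t\<bar>)"
    using set_integral_norm_bound[OF ig] by simp
  also have "\<dots> \<le> (LINT t:{0..}|lborel. h\<^sup>2 / 2 * f (n + 2) (x / 2) t)"
    using pt ig pos by (intro set_integral_mono set_integrable_abs set_integrable_mult_right int) auto
  also have "\<dots> = h\<^sup>2 / 2 * KI (n + 2) (x / 2)"
    by (simp add: KI_def f_def)
  finally show ?thesis .
qed

lemma KI_has_derivative:
  assumes "x > 0"
  shows "(KI n has_real_derivative - KI (Suc n) x) (at x)"
proof -
  have "((\<lambda>h. (KI n (x + h) - KI n x) / h - - KI (Suc n) x) \<longlongrightarrow> 0) (at 0)"
  proof (rule Lim_null_comparison)
    show "((\<lambda>h. \<bar>h\<bar> / 2 * KI (n + 2) (x / 2)) \<longlongrightarrow> 0) (at 0)"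
      by (auto intro!: tendsto_eq_intros)
    have "eventually (\<lambda>h. h \<noteq> 0 \<and> \<bar>h\<bar> < x / 2) (at (0::real))"
      using assms by (auto simp: eventually_at dist_real_def intro!: exI[of _ "x / 2"])
    then show "eventually (\<lambda>h. norm ((KI n (x + h) - KI n x) / h - - KI (Suc n) x) \<le> 
        \<bar>h\<bar> / 2 * KI (n + 2) (x / 2)) (at 0)"
    proof eventually_elim
      fix h assume h: "h \<noteq> 0 \<and> \<bar>h\<bar> < x / 2"
      have "norm ((KI n (x + h) - KI n x) / h - - KI (Suc n) x) = 
          \<bar>KI n (x + h) - KI n x + h * KI (Suc n) x\<bar> / \<bar>h\<bar>"
        using h by (simp add: field_simps flip: abs_divide)
      also have "\<dots> \<le> h\<^sup>2 / 2 * KI (n + 2) (x / 2) / \<bar>h\<bar>"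
        using assms h by (intro divide_right_mono KI_linear_approx) auto
      also have "\<dots> = \<bar>h\<bar> / 2 * KI (n + 2) (x / 2)"
        using h by (simp add: power2_eq_square abs_if)
      finally show "norm ((KI n (x + h) - KI n x) / h - - KI (Suc n) x) \<le> \<bar>h\<bar> / 2 * KI (n + 2) (x / 2)" .
    qed
  qed
  then show ?thesis
    unfolding DERIV_def by (subst LIM_zero_iff[symmetric])
qed

lemma set_integrable_Ioi_KI:
  "x > 0 \<Longrightarrow> set_integrable lborel {0<..} (\<lambda>t::real. cosh t ^ n * exp (- x * cosh t))"
  by (rule set_integrable_subset[OF set_integrable_KI]) auto

lemma KI_Ioi: "KI n x = (LINT t:{0<..}|lborel. cosh t ^ n * exp (- x * cosh t))"
  unfolding KI_def by (rule set_LINT_Ici_eq_Ioi)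

text \<open>The Bessel equation in terms of \<open>KI\<close>: integrate the derivative of sinh t
  exp(-x cosh t), which vanishes at both ends, and use sinh^2 = cosh^2 - 1.\<close>

lemma KI_1_by_parts:
  assumes "x > 0"
  shows "KI 1 x = x * (KI 2 x - KI 0 x)"
proof -
  let ?f = "\<lambda>n t. cosh t ^ n * exp (- x * cosh t)"
  have int: "set_integrable lborel {0<..} (?f n)" for n
    by (rule set_integrable_Ioi_KI[OF assms])
  have "(LINT t:{0<..}|lborel. ?f 1 t - x * (?f 2 t - ?f 0 t)) = 0 - 0"
  proof (rule set_LINT_FTC_Ioi)
    show "((\<lambda>t. sinh t * exp (- x * cosh t)) has_real_derivative ?f 1 t - x * (?f 2 t - ?f 0 t)) (at t)" for t
      using hyperbolic_pythagoras[of t]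
      by (auto intro!: derivative_eq_intros simp: algebra_simps power2_eq_square)
    show "isCont (\<lambda>t. ?f 1 t - x * (?f 2 t - ?f 0 t)) t" for t
      by (intro continuous_intros)
    show "set_integrable lborel {0<..} (\<lambda>t. ?f 1 t - x * (?f 2 t - ?f 0 t))"
      by (intro set_integral_diff set_integrable_mult_right int)
    have "isCont (\<lambda>t. sinh t * exp (- x * cosh t)) 0"
      by (intro continuous_intros)
    then show "((\<lambda>t. sinh t * exp (- x * cosh t)) \<longlongrightarrow> 0) (at_right 0)"
      by (auto simp: isCont_def intro: tendsto_within_subset)
    show "((\<lambda>t. sinh t * exp (- x * cosh t)) \<longlongrightarrow> 0) at_top"
      unfolding sinh_field_def cosh_field_def using assms by real_asymp
  qed
  also have "(LINT t:{0<..}|lborel. ?f 1 t - x * (?f 2 t - ?f 0 t)) = KI 1 x - x * (KI 2 x - KI 0 x)"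
    unfolding KI_Ioi
    by (subst set_integral_diff(2), rule int, intro set_integral_diff set_integrable_mult_right int,
        subst set_integral_mult_right, subst set_integral_diff(2), rule int, rule int, rule refl)
  finally show ?thesis by simp
qed

text \<open>\<open>KI 1\<close> is the Bessel function \<open>K\<^sub>1\<close>.\<close>
definition L1 :: "real \<Rightarrow> real" where
  "L1 x = x * KI 1 x"

lemma L1_measurable [measurable]: "L1 \<in> borel_measurable borel"
  unfolding L1_def by measurable

lemma K0_has_derivative:
  assumes "x > 0"
  shows "(K0 has_real_derivative - L1 x / x) (at x)"
  using KI_has_derivative[OF assms, of 0] assms by (simp add: K0_eq_KI L1_def)

text \<open>With the previous lemma, x d/dx sends \<open>K0\<close> to \<open>- L1\<close> and
  \<open>L1\<close> to -x^2 \<open>K0\<close>. Products of the two functions are thus closed under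
  this operator, up to powers of \<open>x\<close>.\<close>

lemma L1_has_derivative:
  assumes "x > 0"
  shows "(L1 has_real_derivative - x * K0 x) (at x)"
proof -
  have "(L1 has_real_derivative 1 * KI 1 x + - KI (Suc 1) x * x) (at x)"
    unfolding L1_def by (intro DERIV_mult DERIV_ident KI_has_derivative assms)
  also have "1 * KI 1 x + - KI (Suc 1) x * x = - x * K0 x"
    using KI_1_by_parts[OF assms] by (simp add: K0_eq_KI algebra_simps numeral_2_eq_2)
  finally show ?thesis .
qed

text \<open>Write cosh t = sinh t + exp(-t). The sinh part integrates exactly to exp(-x)/x, and the
  rest lies between 0 and exp(-x). Both bounds tend to 1 at 0, which fixes the limit of
  \<open>L1\<close> there.\<close>

lemma L1_bounds:
  assumes "x > 0"
  shows "exp (- x) \<le> L1 x" "L1 x \<le> (1 + x) * exp (- x)"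
proof -
  have isn: "set_integrable lborel {0<..} (\<lambda>t::real. sinh t * exp (- x * cosh t))"
    by (rule set_integrable_bound[OF set_integrable_Ioi_KI[OF assms, of 1]])
       (auto simp: set_borel_measurable_def sinh_def abs_mult, auto simp: cosh_def sinh_def)
  have s: "(LINT t:{0<..}|lborel. sinh t * exp (- x * cosh t)) = 0 - (- exp (- x * cosh 0) / x)"
  proof (rule set_LINT_FTC_Ioi[OF _ _ isn])
    show "((\<lambda>t. - exp (- x * cosh t) / x) has_real_derivative sinh t * exp (- x * cosh t)) (at t)" for t
      using assms by (auto intro!: derivative_eq_intros)
    show "isCont (\<lambda>t. sinh t * exp (- x * cosh t)) t" for t
      by (intro continuous_intros)
    have "isCont (\<lambda>t. - exp (- x * cosh t) / x) 0"
      using assms by (intro continuous_intros) auto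
    then show "((\<lambda>t. - exp (- x * cosh t) / x) \<longlongrightarrow> - exp (- x * cosh 0) / x) (at_right 0)"
      by (auto simp: isCont_def intro: tendsto_within_subset)
    show "((\<lambda>t. - exp (- x * cosh t) / x) \<longlongrightarrow> 0) at_top"
      unfolding cosh_field_def using assms by real_asymp
  qed
  have ie: "set_integrable lborel {0<..} (\<lambda>t. exp (- 1 * t) :: real)"
    by (rule set_integrable_subset[OF set_integrable_exp_neg(1)]) auto
  have e1: "(LINT t:{0<..}|lborel. exp (- 1 * t)) = (1 :: real)"
    using set_integrable_exp_neg(2)[of 1] by (simp add: set_LINT_Ici_eq_Ioi)
  have split: "cosh t ^ 1 * exp (- x * cosh t) = sinh t * exp (- x * cosh t) + exp (- 1 * t) * exp (- x * cosh t)" for t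
  proof -
    have "cosh t = sinh t + exp (- 1 * t)" by (simp add: cosh_def sinh_def field_simps)
    then show ?thesis by (simp add: algebra_simps)
  qed
  have lo: "sinh t * exp (- x * cosh t) \<le> cosh t ^ 1 * exp (- x * cosh t)" for t
    unfolding split by simp
  have hi: "cosh t ^ 1 * exp (- x * cosh t) \<le> sinh t * exp (- x * cosh t) + exp (- x) * exp (- 1 * t)" for t
    unfolding split using cosh_real_ge_1[of t] assms by simp
  have "exp (- x) / x \<le> KI 1 x"
    using set_integral_mono[OF isn set_integrable_Ioi_KI[OF assms] lo] s by (simp add: KI_Ioi)
  then show "exp (- x) \<le> L1 x"
    using assms by (simp add: L1_def field_simps)
  have "KI 1 x \<le> (LINT t:{0<..}|lborel. sinh t * exp (- x * cosh t) + exp (- x) * exp (- 1 * t))"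
    unfolding KI_Ioi
    by (intro set_integral_mono set_integrable_Ioi_KI[OF assms] set_integral_add isn 
        set_integrable_mult_right ie hi)
  also have "\<dots> = exp (- x) / x + exp (- x)"
    by (subst set_integral_add(2)[OF isn set_integrable_mult_right[OF ie]], subst set_integral_mult_right)
       (simp only: s e1, simp)
  finally show "L1 x \<le> (1 + x) * exp (- x)"
    using assms by (simp add: L1_def field_simps)
qed

text \<open>The envelope is x^(-1/4) exp(-x/2), chosen so that its fourth power exp(-2x)/x becomes
  bounded after one multiplication by \<open>x\<close>.\<close>

lemma K0_L1_bound:
  obtains C where "\<And>x. x > 0 \<Longrightarrow> K0 x \<le> C * exp (- ln x / 4 - x / 2)"
    and "\<And>x. x > 0 \<Longrightarrow> L1 x \<le> C * exp (- ln x / 4 - x / 2)"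
proof
  \<comment> \<open>The 4 is the integral of exp(-t/4); the other factor comes from the 4 inside the
    logarithm of x exp(t) / 4 below.\<close>
  define C :: real where "C = 4 * exp (ln 4 / 4)"
  fix x :: real assume x: "x > 0"
  have ln_le: "ln y / 4 \<le> y" "ln y / 4 \<le> y / 4" if "y > 0" for y :: real
    using ln_le_minus_one[OF that] that by auto
  show "K0 x \<le> C * exp (- ln x / 4 - x / 2)"
  proof -
    have pt: "exp (- x * cosh t) \<le> exp (ln 4 / 4) * exp (- ln x / 4 - x / 2) * exp (- (1 / 4) * t)" for t
    proof -
      \<comment> \<open>Half of x cosh t supplies x/2. The other half dominates a quarter of ln(x
        exp(t) / 4), which supplies both x^(-1/4) and the decay in \<open>t\<close>.\<close>
      have "x * exp t / 4 \<le> x * cosh t / 2"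
        using x by (simp add: cosh_def field_simps)
      moreover have "ln (x * exp t / 4) / 4 = (ln x + t - ln 4) / 4"
        using x by (simp add: ln_div ln_mult)
      moreover have "ln (x * exp t / 4) / 4 \<le> x * exp t / 4"
        using x by (intro ln_le) auto
      moreover have "x / 2 \<le> x * cosh t / 2"
        using x cosh_real_ge_1[of t] by simp
      ultimately have "- x * cosh t \<le> ln 4 / 4 + (- ln x / 4 - x / 2) + - (1 / 4) * t"
        by (simp add: field_simps)
      then show ?thesis by (simp flip: exp_add)
    qed
    have "K0 x \<le> (LINT t:{0..}|lborel. exp (ln 4 / 4) * exp (- ln x / 4 - x / 2) * exp (- (1 / 4) * t))"
      unfolding K0_def using set_integrable_KI[OF x, of 0] pt
      by (intro set_integral_mono set_integrable_mult_right set_integrable_exp_neg) auto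
    also have "\<dots> = C * exp (- ln x / 4 - x / 2)"
      unfolding set_integral_mult_right using set_integrable_exp_neg(2)[of "1 / 4"] by (simp add: C_def)
    finally show ?thesis .
  qed
  show "L1 x \<le> C * exp (- ln x / 4 - x / 2)"
  proof -
    have "1 + x \<le> 4 * exp (x / 4)"
      using exp_ge_add_one_self[of "x / 4"] x by linarith
    also have "\<dots> \<le> C * exp (x / 4)"
      by (simp add: C_def)
    also have "\<dots> \<le> C * exp (x / 2 - ln x / 4)"
      using ln_le(2)[OF x] by (simp add: C_def)
    finally have "(1 + x) * exp (- x) \<le> C * exp (x / 2 - ln x / 4) * exp (- x)"
      by (rule mult_right_mono) simp
    also have "\<dots> = C * exp (- ln x / 4 - x / 2)"
      by (simp add: mult.assoc field_simps flip: exp_add)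
    finally show ?thesis
      using L1_bounds(2)[OF x] by simp
  qed
qed

section \<open>Bessel moments\<close>

definition bessel_weight :: "nat \<Rightarrow> nat \<Rightarrow> nat \<Rightarrow> real \<Rightarrow> real" where
  "bessel_weight k i j x = x ^ k * (K0 x ^ i * L1 x ^ j)"

definition bessel_moment :: "nat \<Rightarrow> nat \<Rightarrow> nat \<Rightarrow> real" where
  "bessel_moment k i j = (LINT x:{0<..}|lborel. bessel_weight k i j x)"

lemma K0_nonneg: "K0 x \<ge> 0"
  by (simp add: K0_eq_KI KI_nonneg)

lemma K0_measurable [measurable]: "K0 \<in> borel_measurable borel"
  by (simp add: K0_eq_KI)

lemma L1_nonneg: "x > 0 \<Longrightarrow> L1 x \<ge> 0"
  by (simp add: L1_def KI_nonneg)

lemma bessel_weight_nonneg: "x > 0 \<Longrightarrow> bessel_weight k i j x \<ge> 0"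
  by (simp add: bessel_weight_def K0_nonneg L1_nonneg)

lemma bessel_weight_measurable [measurable]: "bessel_weight k i j \<in> borel_measurable borel"
  unfolding bessel_weight_def by measurable

lemma bessel_weight_Suc: "bessel_weight (Suc k) i j x = x * bessel_weight k i j x"
  by (simp add: bessel_weight_def)

text \<open>One factor \<open>x\<close> cancels the 1/x in the fourth power of the envelope, hence
  \<open>k \<ge> 1\<close>; the remaining power of \<open>x\<close> costs half of the decay
  exp(-2x).\<close>

lemma bessel_weight_bound:
  assumes "k \<ge> 1" "i + j = 4"
  obtains D where "\<And>x. x > 0 \<Longrightarrow> bessel_weight k i j x \<le> D * exp (- x)"
proof -
  obtain C where C: "\<And>x. x > 0 \<Longrightarrow> K0 x \<le> C * exp (- ln x / 4 - x / 2)"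
    "\<And>x. x > 0 \<Longrightarrow> L1 x \<le> C * exp (- ln x / 4 - x / 2)"
    using K0_L1_bound by metis
  obtain m where k: "k = Suc m"
    using assms by (cases k) auto
  have "bessel_weight k i j x \<le> C ^ 4 * fact m * exp (- x)" if x: "x > 0" for x
  proof -
    define w where "w = exp (- ln x / 4 - x / 2)"
    have "x * w ^ 4 = exp (ln x) * exp (4 * (- ln x / 4 - x / 2))"
      unfolding w_def using x by (simp flip: exp_of_nat_mult)
    also have "\<dots> = exp (- x) * exp (- x)"
      by (simp flip: exp_add)
    finally have w: "x * w ^ 4 = exp (- x) * exp (- x)" .
    have "K0 x ^ i * L1 x ^ j \<le> (C * w) ^ i * (C * w) ^ j"
      using C[OF x] x K0_nonneg L1_nonneg order_trans[OF K0_nonneg C(1)[OF x]]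
      unfolding w_def by (intro mult_mono power_mono zero_le_power) auto
    also have "\<dots> = C ^ 4 * w ^ 4"
      by (simp only: assms(2) power_add[symmetric] power_mult_distrib[symmetric])
    finally have "bessel_weight k i j x \<le> x ^ k * (C ^ 4 * w ^ 4)"
      unfolding bessel_weight_def using x by (intro mult_left_mono) auto
    also have "\<dots> = C ^ 4 * x ^ m * (x * w ^ 4)"
      by (simp add: k mult_ac)
    also have "\<dots> = C ^ 4 * (x ^ m) * (exp (- x) * exp (- x))"
      by (simp only: w)
    also have "\<dots> \<le> C ^ 4 * (fact m * exp x) * (exp (- x) * exp (- x))"
      using power_le_fact_mult_exp[of x m] x
      by (intro mult_right_mono mult_left_mono) auto
    also have "\<dots> = C ^ 4 * fact m * exp (- x)"
      by (simp add: exp_minus)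
    finally show ?thesis .
  qed
  then show ?thesis using that by blast
qed

lemma set_integrable_bessel_weight:
  assumes "k \<ge> 1" "i + j = 4"
  shows "set_integrable lborel {0<..} (bessel_weight k i j)"
proof -
  obtain D where D: "\<And>x. x > 0 \<Longrightarrow> bessel_weight k i j x \<le> D * exp (- x)"
    using bessel_weight_bound[OF assms] by blast
  have "set_integrable lborel {0<..} (\<lambda>x::real. exp (- 1 * x))"
    by (rule set_integrable_subset[OF set_integrable_exp_neg(1)]) auto
  then have "set_integrable lborel {0<..} (\<lambda>x::real. D * exp (- 1 * x))"
    by (intro set_integrable_mult_right)
  then show ?thesis
  proof (rule set_integrable_bound)
    show "AE x in lborel. x \<in> {0<..} \<longrightarrow> norm (bessel_weight k i j x) \<le> norm (D * exp (- 1 * x))"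
      using D bessel_weight_nonneg by (auto intro!: AE_I2 order_trans[OF D abs_ge_self[of "_ * _"], simplified])
  qed (simp add: set_borel_measurable_def)
qed

lemma bessel_weight_tendsto_0:
  assumes "k \<ge> 1" "i + j = 4"
  shows "(bessel_weight (Suc k) i j \<longlongrightarrow> 0) (at_right 0)"
    and "(bessel_weight (Suc k) i j \<longlongrightarrow> 0) at_top"
proof -
  obtain D where D: "\<And>x. x > 0 \<Longrightarrow> bessel_weight k i j x \<le> D * exp (- x)"
    using bessel_weight_bound[OF assms] by blast
  have b: "norm (bessel_weight (Suc k) i j x) \<le> x * (D * exp (- x))" if "x > 0" for x
    using D[OF that] bessel_weight_nonneg[OF that] that by (simp add: bessel_weight_Suc abs_mult)
  show "(bessel_weight (Suc k) i j \<longlongrightarrow> 0) (at_right 0)"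
  proof (rule Lim_null_comparison)
    show "\<forall>\<^sub>F x in at_right 0. norm (bessel_weight (Suc k) i j x) \<le> x * (D * exp (- x))"
      using b by (auto simp: eventually_at_filter)
    show "((\<lambda>x. x * (D * exp (- x))) \<longlongrightarrow> 0) (at_right 0)"
      by (auto intro!: tendsto_eq_intros)
  qed
  show "(bessel_weight (Suc k) i j \<longlongrightarrow> 0) at_top"
  proof (rule Lim_null_comparison)
    show "\<forall>\<^sub>F x in at_top. norm (bessel_weight (Suc k) i j x) \<le> x * (D * exp (- x))"
      using eventually_gt_at_top[of 0] by eventually_elim (rule b)
    have "((\<lambda>x::real. D * (x * exp (- x))) \<longlongrightarrow> D * 0) at_top"
      by (intro tendsto_mult_left) real_asymp
    then show "((\<lambda>x. x * (D * exp (- x))) \<longlongrightarrow> 0) at_top"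
      by (simp add: mult.left_commute)
  qed
qed

lemma bessel_weight_isCont:
  assumes "x > 0"
  shows "isCont (bessel_weight k i j) x"
  unfolding bessel_weight_def
  by (intro continuous_intros DERIV_isCont[OF K0_has_derivative[OF assms]] 
      DERIV_isCont[OF L1_has_derivative[OF assms]])

lemma bessel_weight_has_derivative:
  assumes x: "x > 0"
  shows "(bessel_weight (Suc k) i j has_real_derivative
    real (Suc k) * bessel_weight k i j x
    - (real i * bessel_weight k (i - 1) (j + 1) x
       + real j * bessel_weight (k + 2) (i + 1) (j - 1) x)) (at x)"
proof -
  note d = K0_has_derivative[OF x] L1_has_derivative[OF x]
  have "((\<lambda>x. x ^ Suc k * (K0 x ^ i * L1 x ^ j)) has_real_derivative
     real (Suc k) * x ^ k * (K0 x ^ i * L1 x ^ j) +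
     (real i * K0 x ^ (i - 1) * (- L1 x / x) * L1 x ^ j +
      real j * L1 x ^ (j - 1) * (- x * K0 x) * K0 x ^ i) * x ^ Suc k) (at x)"
    by (rule derivative_eq_intros d refl | simp)+
  also have "real (Suc k) * x ^ k * (K0 x ^ i * L1 x ^ j) +
     (real i * K0 x ^ (i - 1) * (- L1 x / x) * L1 x ^ j +
      real j * L1 x ^ (j - 1) * (- x * K0 x) * K0 x ^ i) * x ^ Suc k =
    real (Suc k) * bessel_weight k i j x
    - (real i * bessel_weight k (i - 1) (j + 1) x
       + real j * bessel_weight (k + 2) (i + 1) (j - 1) x)"
    using x by (simp add: bessel_weight_def field_simps)
  finally show ?thesis
    by (simp add: bessel_weight_def[abs_def])
qed

text \<open>Integrates the derivative of \<open>bessel_weight (Suc k) i j\<close>, whose boundary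
  values vanish.\<close>

lemma bessel_moment_relation:
  assumes "k \<ge> 1" "i + j = 4"
  shows "real (Suc k) * bessel_moment k i j =
    real i * bessel_moment k (i - 1) (j + 1) + real j * bessel_moment (k + 2) (i + 1) (j - 1)"
proof -
  have i0: "set_integrable lborel {0<..} (\<lambda>x. real (Suc k) * bessel_weight k i j x)"
    by (intro set_integrable_mult_right set_integrable_bessel_weight assms)
  \<comment> \<open>For \<open>i = 0\<close> the exponents no longer add up to 4, but integrability
    is required only when the scalar factor is nonzero. The same applies to \<open>j = 0\<close>
    below.\<close>
  have i1: "set_integrable lborel {0<..} (\<lambda>x. real i * bessel_weight k (i - 1) (j + 1) x)"
    using assms by (intro set_integrable_mult_right set_integrable_bessel_weight) auto
  have i2: "set_integrable lborel {0<..} (\<lambda>x. real j * bessel_weight (k + 2) (i + 1) (j - 1) x)"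
    using assms by (intro set_integrable_mult_right set_integrable_bessel_weight) auto
  note i12 = set_integral_add[OF i1 i2]
  have "(LINT x:{0<..}|lborel. real (Suc k) * bessel_weight k i j x
    - (real i * bessel_weight k (i - 1) (j + 1) x
       + real j * bessel_weight (k + 2) (i + 1) (j - 1) x)) = 0 - 0"
    by (rule set_LINT_FTC_Ioi[OF bessel_weight_has_derivative _ set_integral_diff(1)[OF i0 i12(1)]
          bessel_weight_tendsto_0[OF assms]])
       (auto intro!: continuous_intros bessel_weight_isCont)
  then show ?thesis
    unfolding set_integral_diff(2)[OF i0 i12(1)] i12(2) set_integral_mult_right bessel_moment_def
    by simp
qed

lemma L1_tendsto: "(L1 \<longlongrightarrow> 1) (at_right 0)" "(L1 \<longlongrightarrow> 0) at_top"
proof -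
  have ev: "\<forall>\<^sub>F x in at_right 0. x > (0::real)"
    by (auto simp: eventually_at_filter)
  show "(L1 \<longlongrightarrow> 1) (at_right 0)"
  proof (rule tendsto_sandwich)
    show "\<forall>\<^sub>F x in at_right 0. exp (- x) \<le> L1 x" "\<forall>\<^sub>F x in at_right 0. L1 x \<le> (1 + x) * exp (- x)"
      using ev by (eventually_elim, simp add: L1_bounds)+
  qed (auto intro!: tendsto_eq_intros)
  show "(L1 \<longlongrightarrow> 0) at_top"
  proof (rule tendsto_sandwich)
    show "\<forall>\<^sub>F x in at_top. 0 \<le> L1 x" "\<forall>\<^sub>F x in at_top. L1 x \<le> (1 + x) * exp (- x)"
      using eventually_gt_at_top[of 0] by (eventually_elim, simp add: L1_bounds L1_nonneg)+
    show "((\<lambda>x::real. (1 + x) * exp (- x)) \<longlongrightarrow> 0) at_top"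
      by real_asymp
  qed auto
qed

text \<open>Unlike all other boundary terms, the one of \<open>L1 ^ 4\<close> at 0 does not vanish.\<close>
lemma bessel_moment_1_1_3: "bessel_moment 1 1 3 = 1 / 4"
proof -
  have "(LINT x:{0<..}|lborel. - 4 * bessel_weight 1 1 3 x) = 0 ^ 4 - 1 ^ 4"
  proof (rule set_LINT_FTC_Ioi)
    show "((\<lambda>x. L1 x ^ 4) has_real_derivative - 4 * bessel_weight 1 1 3 x) (at x)" if "x > 0" for x
      by (rule derivative_eq_intros L1_has_derivative[OF that] refl)+
         (simp add: bessel_weight_def)
    show "isCont (\<lambda>x. - 4 * bessel_weight 1 1 3 x) x" if "x > 0" for x
      by (intro continuous_intros bessel_weight_isCont that)
    show "set_integrable lborel {0<..} (\<lambda>x. - 4 * bessel_weight 1 1 3 x)"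
      by (intro set_integrable_mult_right set_integrable_bessel_weight) auto
  qed (intro tendsto_power L1_tendsto)+
  then show ?thesis
    unfolding set_integral_mult_right by (simp add: bessel_moment_def)
qed

text \<open>The relations for \<open>k = 1\<close> descend from \<open>bessel_moment 1 4 0\<close>
  to the known \<open>bessel_moment 1 1 3\<close>; the one for \<open>k = 3\<close> identifies the
  two moments with \<open>x ^ 3\<close>, closing the linear system.\<close>

lemma bessel_moment_3_4_0: "bessel_moment 3 4 0 = bessel_moment 1 4 0 / 4 - 3 / 16"
proof -
  have "2 * bessel_moment 1 4 0 = 4 * bessel_moment 1 3 1"
    using bessel_moment_relation[of 1 4 0] by (simp add: eval_nat_numeral)
  moreover have "2 * bessel_moment 1 3 1 = 3 * bessel_moment 1 2 2 + bessel_moment 3 4 0"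
    using bessel_moment_relation[of 1 3 1] by (simp add: eval_nat_numeral)
  moreover have "2 * bessel_moment 1 2 2 = 2 * bessel_moment 1 1 3 + 2 * bessel_moment 3 3 1"
    using bessel_moment_relation[of 1 2 2] by (simp add: eval_nat_numeral)
  moreover have "4 * bessel_moment 3 4 0 = 4 * bessel_moment 3 3 1"
    using bessel_moment_relation[of 3 4 0] by (simp add: eval_nat_numeral)
  ultimately show ?thesis
    using bessel_moment_1_1_3 by linarith
qed

text \<open>Replacing N by 1 - N exchanges n + 2 with -(n+1), fixes 5N^2 - 5N + 2 and negates 2N -
  1. The elimination used for the Domb numbers therefore yields the same cubic polynomial
  here.\<close>

lemma bessel_moment_recurrence:
  "64 * (real n + 1) ^ 5 * bessel_moment (2 * n + 1) 4 0
    - 32 * (2 * real n + 3) * (5 * (real n)\<^sup>2 + 15 * real n + 12) * bessel_moment (2 * n + 3) 4 0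
    + 256 * (real n + 2) * bessel_moment (2 * n + 5) 4 0 = 0"
proof -
  define N where "N = - (real n + 1)"
  define m where "m l j = bessel_moment (2 * n + 1 + 2 * l) (4 - j) j" for l j
  have rel: "(N - real l) * m l j = - (real (4 - j) * m l (j + 1) + real j * m (l + 1) (j - 1)) / 2"
    if "j \<le> 4" for l j
  proof -
    have e: "4 - j - 1 = 4 - (j + 1)" "2 * n + 1 + 2 * l + 2 = 2 * n + 1 + 2 * (l + 1)"
      "real (Suc (2 * n + 1 + 2 * l)) = - 2 * (N - real l)"
      by (simp_all add: N_def)
    have "j = 0 \<or> 4 - j + 1 = 4 - (j - 1)"
      using that by auto
    then have "real j * bessel_moment (2 * n + 1 + 2 * (l + 1)) (4 - j + 1) (j - 1) = real j * m (l + 1) (j - 1)"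
      by (elim disjE) (simp_all only: m_def of_nat_0 mult_zero_left)
    moreover have "1 \<le> 2 * n + 1 + 2 * l" "4 - j + j = 4"
      using that by auto
    note bessel_moment_relation[OF this, unfolded e]
    ultimately have "- 2 * (N - real l) * m l j = real (4 - j) * m l (j + 1) + real j * m (l + 1) (j - 1)"
      by (simp only: m_def)
    moreover have "a * b = - c / 2" if "- 2 * a * b = c" for a b c :: real
      using that by auto
    ultimately show ?thesis by blast
  qed
  have "N ^ 5 * m 0 0 - 4 * (2 * N - 1) * (5 * N\<^sup>2 - 5 * N + 2) / 2 * (m 1 0 / 4)
    + 64 * (N - 1) * (m 2 0 / 16) = 0"
    \<comment> \<open>The moment \<open>m l j\<close> is scaled by (-1/2)^j / 4^l.\<close>
    by (rule domb_recurrence_elimination[where ?g1.0 = "- m 0 1 / 2" and ?g1' = "- m 1 1 / 8"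
          and ?g1'' = "- m 2 1 / 32" and ?g2.0 = "m 0 2 / 4" and ?g2' = "m 1 2 / 16"
          and ?g3.0 = "- m 0 3 / 8" and ?g3' = "- m 1 3 / 32" and ?g4.0 = "m 0 4 / 16"])
       (use rel[of 0 0] rel[of 0 1] rel[of 0 2] rel[of 1 0] rel[of 1 1] rel[of 2 0] rel[of 2 1]
            rel[of 3 0] rel[of 4 0] in \<open>simp_all add: eval_nat_numeral\<close>)
  moreover define P where "P = (2 * real n + 3) * (5 * (real n)\<^sup>2 + 15 * real n + 12)"
  moreover have "4 * (2 * N - 1) * (5 * N\<^sup>2 - 5 * N + 2) / 2 = - 2 * P"
    by (simp add: N_def P_def field_simps power2_eq_square)
  moreover have "N ^ 5 = - ((real n + 1) ^ 5)"
    unfolding N_def by (rule power_minus_odd) simp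
  moreover have "N - 1 = - (real n + 2)"
    by (simp add: N_def)
  ultimately have *: "- ((real n + 1) ^ 5) * m 0 0 - - 2 * P * (m 1 0 / 4)
      + 64 * - (real n + 2) * (m 2 0 / 16) = 0"
    by (simp only:)
  have m: "m 0 0 = bessel_moment (2 * n + 1) 4 0" "m 1 0 = bessel_moment (2 * n + 3) 4 0"
    "m 2 0 = bessel_moment (2 * n + 5) 4 0"
    by (simp_all add: m_def eval_nat_numeral)
  have "64 * X * a - 32 * P * b + 256 * Y * c =
      - 64 * (- X * a - - 2 * P * (b / 4) + 64 * - Y * (c / 16))" for X Y a b c :: real
    by (simp add: algebra_simps)
  note this[of "(real n + 1) ^ 5" "m 0 0" "m 1 0" "real n + 2" "m 2 0", unfolded *, unfolded m]
  then show ?thesis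
    unfolding P_def by (simp only: mult.assoc mult_zero_right)
qed

section \<open>The sequence \<open>d_seq\<close>, its initial values and the conclusion\<close>

lemma d_seq_eq: "d_seq n = 16 ^ n / (fact n)\<^sup>2 * bessel_moment (2 * n + 1) 4 0"
  by (simp add: d_seq_def bessel_moment_def bessel_weight_def)

text \<open>The moment recurrence multiplied by 16^n / ((n+1)!)^2.\<close>

lemma d_seq_recurrence:
  "(real n + 2) ^ 3 * d_seq (n + 2)
     - 2 * (2 * real n + 3) * (5 * (real n)\<^sup>2 + 15 * real n + 12) * d_seq (n + 1)
     + 64 * (real n + 1) ^ 3 * d_seq n = 0"
proof -
  define F where "F = (fact n :: real)"
  define P where "P = 2 * (2 * real n + 3) * (5 * (real n)\<^sup>2 + 15 * real n + 12)"
  define x y where "x = real n + 1" and "y = real n + 2"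
  define c where "c l = bessel_moment (2 * n + 1 + 2 * l) 4 0" for l
  have nz: "F \<noteq> 0" "x \<noteq> 0" "y \<noteq> 0" by (simp_all add: F_def x_def y_def)
  have d: "d_seq n = 16 ^ n / F\<^sup>2 * c 0" "d_seq (n + 1) = 16 * 16 ^ n / (x * F)\<^sup>2 * c 1"
    "d_seq (n + 2) = 256 * 16 ^ n / (y * (x * F))\<^sup>2 * c 2"
  proof -
    have "2 * (n + 1) + 1 = 2 * n + 1 + 2 * 1" "2 * (n + 2) + 1 = 2 * n + 1 + 2 * 2"
      by simp_all
    then have "bessel_moment (2 * n + 1) 4 0 = c 0" "bessel_moment (2 * (n + 1) + 1) 4 0 = c 1"
      "bessel_moment (2 * (n + 2) + 1) 4 0 = c 2"
      unfolding c_def by (simp_all only: mult_0_right add_0_right)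
    moreover have "(fact (n + 1) :: real) = x * F" "(fact (n + 2) :: real) = y * (x * F)"
      by (simp_all add: F_def x_def y_def algebra_simps)
    ultimately show "d_seq n = 16 ^ n / F\<^sup>2 * c 0" "d_seq (n + 1) = 16 * 16 ^ n / (x * F)\<^sup>2 * c 1"
      "d_seq (n + 2) = 256 * 16 ^ n / (y * (x * F))\<^sup>2 * c 2"
      unfolding d_seq_eq by (simp_all only:) (simp_all add: F_def)
  qed
  have "y ^ 3 * d_seq (n + 2) - P * d_seq (n + 1) + 64 * x ^ 3 * d_seq n =
      16 ^ n / (x * F)\<^sup>2 * (64 * x ^ 5 * c 0 - 16 * P * c 1 + 256 * y * c 2)"
    unfolding d using nz by (simp add: field_simps power2_eq_square eval_nat_numeral)
  also have "64 * x ^ 5 * c 0 - 16 * P * c 1 + 256 * y * c 2 = 0"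
  proof -
    have "c 0 = bessel_moment (2 * n + 1) 4 0" "c 1 = bessel_moment (2 * n + 3) 4 0"
      "c 2 = bessel_moment (2 * n + 5) 4 0"
      by (simp_all add: c_def eval_nat_numeral)
    moreover have "16 * P = 32 * (2 * real n + 3) * (5 * (real n)\<^sup>2 + 15 * real n + 12)"
      by (simp add: P_def)
    ultimately show ?thesis
      using bessel_moment_recurrence[of n] by (simp only: x_def y_def)
  qed
  finally show ?thesis
    by (simp add: x_def y_def P_def)
qed

text \<open>cosh is even, so the negative half-line contributes the same amount as the positive
  one.\<close>

lemma k0_eq_K0:
  assumes "x > 0"
  shows "k0 x = 2 * ennreal (K0 x)"
proof -
  let ?f = "\<lambda>t. exp (- x * cosh t)"
  have "k0 x = (\<integral>\<^sup>+t. ennreal (?f t) * indicator {0..} t + ennreal (?f t) * indicator {..<0} t \<partial>lborel)"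
    unfolding k0_def by (rule nn_integral_cong) (auto simp: indicator_def)
  also have "\<dots> = (\<integral>\<^sup>+t. ennreal (?f t) * indicator {0..} t \<partial>lborel) +
      (\<integral>\<^sup>+t. ennreal (?f t) * indicator {..<0} t \<partial>lborel)"
    by (rule nn_integral_add) auto
  also have "(\<integral>\<^sup>+t. ennreal (?f t) * indicator {..<0} t \<partial>lborel) =
      (\<integral>\<^sup>+t. ennreal (?f (0 + -1 * t)) * indicator {..<0} (0 + -1 * t) \<partial>lborel)"
    by (subst nn_integral_real_affine[where c = "-1" and t = 0]) auto
  also have "\<dots> = (\<integral>\<^sup>+t. ennreal (?f t) * indicator {0..} t \<partial>lborel)"
    by (rule nn_integral_cong_AE, use AE_lborel_singleton[of "0::real"] in eventually_elim)
       (auto simp: indicator_def)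
  also have "(\<integral>\<^sup>+t. ennreal (?f t) * indicator {0..} t \<partial>lborel) =
      (\<integral>\<^sup>+t. ennreal (indicator {0..} t *\<^sub>R ?f t) \<partial>lborel)"
    by (rule nn_integral_cong) (auto simp: indicator_def)
  also have "\<dots> = ennreal (K0 x)"
    unfolding K0_def set_lebesgue_integral_def
    using set_integrable_KI[OF assms, of 0]
    by (intro nn_integral_eq_integral) (auto simp: set_integrable_def)
  finally show ?thesis by (simp add: mult_2)
qed

lemma bessel_moment_1_4_0: "bessel_moment 1 4 0 = 7 / 8 * zeta3"
proof -
  have "(\<integral>\<^sup>+x. ennreal x * k0 x ^ 4 \<partial>lborel) =
      (\<integral>\<^sup>+x. 16 * ennreal (indicator {0<..} x *\<^sub>R bessel_weight 1 4 0 x) \<partial>lborel)"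
  proof (rule nn_integral_cong)
    fix x :: real
    show "ennreal x * k0 x ^ 4 = 16 * ennreal (indicator {0<..} x *\<^sub>R bessel_weight 1 4 0 x)"
    proof (cases "x > 0")
      case True
      then have "k0 x ^ 4 = 16 * ennreal (K0 x ^ 4)"
        by (simp add: k0_eq_K0 power_mult_distrib ennreal_power K0_nonneg)
      with True show ?thesis
        by (simp add: bessel_weight_def ennreal_mult K0_nonneg mult.left_commute)
    qed (simp add: ennreal_neg)
  qed
  also have "\<dots> = 16 * (\<integral>\<^sup>+x. ennreal (indicator {0<..} x *\<^sub>R bessel_weight 1 4 0 x) \<partial>lborel)"
    by (rule nn_integral_cmult) measurable
  also have "(\<integral>\<^sup>+x. ennreal (indicator {0<..} x *\<^sub>R bessel_weight 1 4 0 x) \<partial>lborel) =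
      ennreal (bessel_moment 1 4 0)"
    unfolding bessel_moment_def set_lebesgue_integral_def
    using set_integrable_bessel_weight[of 1 4 0]
    by (intro nn_integral_eq_integral)
       (auto simp: set_integrable_def indicator_def bessel_weight_nonneg)
  finally have "16 * (\<Sum>k. ennreal (1 / real (2 * k + 1) ^ 3)) = 16 * ennreal (bessel_moment 1 4 0)"
    unfolding k0_fourth_moment .
  moreover have "(\<Sum>k. ennreal (1 / real (2 * k + 1) ^ 3)) = ennreal (7 / 8 * zeta3)"
    by (rule suminf_ennreal_eq[OF _ sums_inverse_odd_cubes]) simp
  ultimately have "ennreal (16 * (7 / 8 * zeta3)) = ennreal (16 * bessel_moment 1 4 0)"
    by (simp only: ennreal_mult') simp
  moreover have "7 / 8 * zeta3 \<ge> 0"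
    by (rule sums_le[OF _ sums_zero sums_inverse_odd_cubes]) auto
  moreover have "bessel_moment 1 4 0 \<ge> 0"
    unfolding bessel_moment_def set_lebesgue_integral_def
    by (intro integral_nonneg_AE AE_I2) (auto simp: indicator_def bessel_weight_nonneg)
  ultimately show ?thesis
    by (subst (asm) ennreal_inj) auto
qed

theorem mainTheorem2:
  fixes B :: "nat \<Rightarrow> real"
  assumes "B 0 = 0" and "B 1 = 1"
    and "\<And>n. (real n + 2) ^ 3 * B (n + 2)
              - 2 * (2 * real n + 3) * (5 * (real n)^2 + 15 * real n + 12) * B (n + 1)
              + 64 * (real n + 1) ^ 3 * B n = 0"
  shows "\<forall>n. d_seq n = 7 / 8 * A_seq n * zeta3 - 3 * B n"
proof
  fix n
  show "d_seq n = 7 / 8 * A_seq n * zeta3 - 3 * B n"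
  proof (induction n rule: induct_nat_012)
    case 0
    show ?case
      using assms(1) bessel_moment_1_4_0 by (simp add: d_seq_eq A_seq_0)
  next
    case 1
    \<comment> \<open>With c = \<open>bessel_moment 1 4 0\<close>, the value is 16 (c/4 - 3/16) = 4c
      - 3.\<close>
    show ?case
      using assms(2) bessel_moment_1_4_0 bessel_moment_3_4_0 A_seq_1
      by (simp add: d_seq_eq eval_nat_numeral)
  next
    case (ge2 n)
    define P where "P = 2 * (2 * real n + 3) * (5 * (real n)\<^sup>2 + 15 * real n + 12)"
    define Q where "Q = 64 * (real n + 1) ^ 3"
    define z where "z = 7 / 8 * zeta3"
    \<comment> \<open>The defect of the claimed identity satisfies the same linear recurrence, and
      its leading coefficient (n+2)^3 is nonzero, so two consecutive zeros force the next
      one.\<close>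
    define e where "e k = d_seq k - (A_seq k * z - 3 * B k)" for k
    have rec: "(real n + 2) ^ 3 * d_seq (n + 2) = P * d_seq (n + 1) - Q * d_seq n"
      "(real n + 2) ^ 3 * A_seq (n + 2) = P * A_seq (n + 1) - Q * A_seq n"
      "(real n + 2) ^ 3 * B (n + 2) = P * B (n + 1) - Q * B n"
      using d_seq_recurrence[of n] A_seq_recurrence[of n] assms(3)[of n]
      unfolding P_def Q_def by linarith+
    have "(real n + 2) ^ 3 * e (n + 2) = (real n + 2) ^ 3 * d_seq (n + 2) -
        ((real n + 2) ^ 3 * A_seq (n + 2) * z - 3 * ((real n + 2) ^ 3 * B (n + 2)))"
      by (simp add: e_def algebra_simps)
    also have "\<dots> = P * e (n + 1) - Q * e n"
      unfolding rec by (simp add: e_def algebra_simps)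
    also have "\<dots> = 0"
      using ge2 by (simp add: e_def z_def)
    finally have "e (n + 2) = 0" by simp
    then show ?case by (simp add: e_def z_def)
  qed
qed

end
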